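(* Let $d\ge3$ be an integer and let $z\in\mathbb{C}\setminus[0,\infty)$. Then $$\big\||x|^{-1}(-\Delta-z)^{-1}|x|^{-1}\big\|_{L^2(\mathbb{R}^d)\to L^2(\mathbb{R}^d)}\ge\left(\frac d2-1\right)^{-2}.$$
   Context: $-\Delta$ is the self-adjoint Laplacian in $L^2(\mathbb{R}^d)$ with domain $H^2(\mathbb{R}^d)$, and $|x|^{-1}$ denotes the operator of multiplication by $1/|x|$. For $z\in\mathbb{C}\setminus[0,\infty)$ and $d\ge3$ the operator $|x|^{-1}(-\Delta-z)^{-1}|x|^{-1}$, defined e.g. on $C_0^\infty(\mathbb{R}^d\setminus\{0\})$, extends to a bounded operator on $L^2(\mathbb{R}^d)$, whose operator norm is meant. *)

theory Defs
  imports "HOL-Analysis.Analysis"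
begin

text \<open>
  Elements of \<open>L\<^sup>2\<close> are represented by Borel functions, and equality in \<open>L\<^sup>2\<close> is equality almost
  everywhere. A (possibly unbounded) operator in \<open>L\<^sup>2\<close> is represented by its graph, which contains
  all representatives of each pair. Thus inverses are converses, operator products are relational
  compositions, and the domain of a product is the natural one.
\<close>

type_synonym 'a l2_operator = "(('a \<Rightarrow> complex) \<times> ('a \<Rightarrow> complex)) set"

definition L2 :: "('a::euclidean_space \<Rightarrow> complex) set" where
  "L2 = {f. f \<in> borel_measurable lborel \<and> integrable lborel (\<lambda>x. (cmod (f x))\<^sup>2)}"

definition l2_norm :: "('a::euclidean_space \<Rightarrow> complex) \<Rightarrow> real" where
  "l2_norm f = sqrt (LINT x|lborel. (cmod (f x))\<^sup>2)"

primrec C_k :: "nat \<Rightarrow> ('a::euclidean_space \<Rightarrow> complex) \<Rightarrow> bool" where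
  "C_k 0 f \<longleftrightarrow> continuous_on UNIV f"
| "C_k (Suc k) f \<longleftrightarrow>
     (\<forall>x. f differentiable at x) \<and> (\<forall>v. C_k k (\<lambda>x. frechet_derivative f (at x) v))"

definition test_functions :: "'a::euclidean_space set \<Rightarrow> ('a \<Rightarrow> complex) set" where
  "test_functions \<Omega> =
     {f. (\<forall>k. C_k k f) \<and> compact (closure {x. f x \<noteq> 0}) \<and> closure {x. f x \<noteq> 0} \<subseteq> \<Omega>}"

definition weak_deriv ::
  "'a::euclidean_space \<Rightarrow> ('a \<Rightarrow> complex) \<Rightarrow> ('a \<Rightarrow> complex) \<Rightarrow> bool" where
  "weak_deriv b u g \<longleftrightarrow>
     (\<forall>\<phi>\<in>test_functions UNIV.
        (LINT x|lborel. u x * frechet_derivative \<phi> (at x) b) = - (LINT x|lborel. g x * \<phi> x))"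

definition H1 :: "('a::euclidean_space \<Rightarrow> complex) set" where
  "H1 = {u \<in> L2. \<forall>b\<in>Basis. \<exists>g\<in>L2. weak_deriv b u g}"

definition H2 :: "('a::euclidean_space \<Rightarrow> complex) set" where
  "H2 = {u \<in> L2. \<forall>b\<in>Basis. \<exists>g\<in>H1. weak_deriv b u g}"

definition neg_laplacian :: "'a::euclidean_space l2_operator" where
  "neg_laplacian = {(u, v). u \<in> H2 \<and> v \<in> L2 \<and>
     (\<exists>g h. (\<forall>b\<in>Basis. g b \<in> H1 \<and> h b \<in> L2 \<and> weak_deriv b u (g b) \<and> weak_deriv b (g b) (h b)) \<and>
            (AE x in lborel. v x = - (\<Sum>b\<in>Basis. h b x)))}"

definition minus_scalar :: "'a::euclidean_space l2_operator \<Rightarrow> complex \<Rightarrow> 'a l2_operator" where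
  "minus_scalar A z =
     {(u, w). w \<in> L2 \<and> (\<exists>v. (u, v) \<in> A \<and> (AE x in lborel. w x = v x - z * u x))}"

definition resolvent :: "'a::euclidean_space l2_operator \<Rightarrow> complex \<Rightarrow> 'a l2_operator" where
  "resolvent A z = (minus_scalar A z)\<inverse>"

definition mult_operator :: "('a::euclidean_space \<Rightarrow> real) \<Rightarrow> 'a l2_operator" where
  "mult_operator V =
     {(f, g). f \<in> L2 \<and> g \<in> L2 \<and> (AE x in lborel. g x = complex_of_real (V x) * f x)}"

text \<open>The convention \<open>inverse 0 = 0\<close> only affects the null set \<open>{0}\<close>.\<close>

definition sandwiched_resolvent :: "complex \<Rightarrow> 'a::euclidean_space l2_operator" where
  "sandwiched_resolvent z =
     {(f, g). f \<in> test_functions (UNIV - {0}) \<and>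
        (f, g) \<in> mult_operator (\<lambda>x. inverse (norm x)) O resolvent neg_laplacian z
                 O mult_operator (\<lambda>x. inverse (norm x))}"

text \<open>
  The closure of the graph in \<open>L\<^sup>2 \<times> L\<^sup>2\<close>. For a densely defined bounded operator this is the graph
  of its unique bounded extension to all of \<open>L\<^sup>2\<close>.
\<close>

definition l2_extension :: "'a::euclidean_space l2_operator \<Rightarrow> 'a l2_operator" where
  "l2_extension T = {(f, g). f \<in> L2 \<and> g \<in> L2 \<and>
     (\<exists>F G. (\<forall>n::nat. (F n, G n) \<in> T) \<and>
            (\<lambda>n. l2_norm (\<lambda>x. F n x - f x)) \<longlonglongrightarrow> 0 \<and>
            (\<lambda>n. l2_norm (\<lambda>x. G n x - g x)) \<longlonglongrightarrow> 0)}"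

definition operator_norm :: "'a::euclidean_space l2_operator \<Rightarrow> ennreal" where
  "operator_norm T = (SUP (f, g)\<in>{(f, g)\<in>T. l2_norm f \<le> 1}. ennreal (l2_norm g))"

end

theory Submission
  imports Defs
begin

text \<open>
  For a test function \<open>u\<close> supported away from the origin, the sandwiched resolvent maps
  \<open>f = \<bar>x\<bar> (-\<Delta> - z) u\<close> to \<open>g = \<bar>x\<bar>\<^sup>-\<^sup>1 u\<close>, so it suffices to find \<open>u\<close> for which \<open>\<parallel>f\<parallel> / \<parallel>g\<parallel>\<close> is close to
  \<open>c = (d/2 - 1)\<^sup>2\<close>. With \<open>\<tau> = ln \<bar>x\<bar>\<^sup>2\<close> and \<open>u = \<bar>x\<bar>\<^sup>-\<^sup>(\<^sup>d\<^sup>-\<^sup>2\<^sup>)\<^sup>/\<^sup>2 F(\<tau>)\<close> one finds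
  \<open>f = \<bar>x\<bar>\<^sup>-\<^sup>d\<^sup>/\<^sup>2 (c F - 4 F'' - z e\<^sup>\<tau> F)(\<tau>)\<close> and \<open>g = \<bar>x\<bar>\<^sup>-\<^sup>d\<^sup>/\<^sup>2 F(\<tau>)\<close>. As \<open>\<bar>x\<bar>\<^sup>-\<^sup>d dx\<close> is invariant
  under dilations, that is, under translations of \<open>\<tau>\<close>, spreading \<open>F\<close> over a long interval makes \<open>F''\<close>
  negligible, and moving this interval towards \<open>-\<infinity>\<close> does the same to the term with \<open>z\<close>.
\<close>

subsection \<open>Differentiability classes\<close>

text \<open>\<open>frechet_derivative\<close> is a choice operator; uniqueness of derivatives lets
  an explicitly computed \<open>D\<close> stand in for it.\<close>

lemma C_k_SucI:
  assumes "\<And>x. (f has_derivative D x) (at x)" and "\<And>v. C_k k (\<lambda>x. D x v)"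
  shows "C_k (Suc k) f"
proof -
  have "frechet_derivative f (at x) = D x" for x
    using frechet_derivative_at[OF assms(1)] by simp
  then show ?thesis
    using assms by (auto simp: differentiable_def)
qed

text \<open>The recursion constrains only the derivatives of \<open>f\<close>, so the class is
  lowered by induction, starting from differentiable functions being continuous.\<close>

lemma C_k_SucD: "C_k (Suc k) f \<Longrightarrow> C_k k f"
proof (induction k arbitrary: f)
  case 0
  then show ?case
    by (auto simp: continuous_on_eq_continuous_at intro: differentiable_imp_continuous_within)
next
  case (Suc k)
  have "C_k (Suc k) (\<lambda>x. frechet_derivative f (at x) v)" for v
    using Suc.prems[unfolded C_k.simps(2)[of "Suc k" f]] by (rule conjunct2[THEN spec])
  from Suc.IH[OF this] have "\<And>v. C_k k (\<lambda>x. frechet_derivative f (at x) v)" .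
  then show ?case
    using Suc.prems by simp
qed

lemma C_k_has_derivative:
  "C_k (Suc k) f \<Longrightarrow> (f has_derivative frechet_derivative f (at x)) (at x)"
  by (simp add: frechet_derivative_works)

lemma C_k_const: "C_k k (\<lambda>x. c)"
proof (induction k arbitrary: c)
  case (Suc k)
  show ?case
    by (rule C_k_SucI[where D = "\<lambda>_ _. 0"]) (auto intro: Suc)
qed auto

lemma C_k_add: "C_k k f \<Longrightarrow> C_k k g \<Longrightarrow> C_k k (\<lambda>x. f x + g x)"
proof (induction k arbitrary: f g)
  case 0
  then show ?case by (auto intro: continuous_intros)
next
  case (Suc k)
  show ?case
  proof (rule C_k_SucI)
    show "((\<lambda>x. f x + g x) has_derivative
        (\<lambda>v. frechet_derivative f (at x) v + frechet_derivative g (at x) v)) (at x)" for x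
      by (intro has_derivative_add C_k_has_derivative[OF Suc.prems(1)] C_k_has_derivative[OF Suc.prems(2)])
  qed (use Suc in auto)
qed

lemma C_k_mult: "C_k k f \<Longrightarrow> C_k k g \<Longrightarrow> C_k k (\<lambda>x. f x * g x)"
proof (induction k arbitrary: f g)
  case 0
  then show ?case by (auto intro: continuous_intros)
next
  case (Suc k)
  show ?case
  proof (rule C_k_SucI)
    show "((\<lambda>x. f x * g x) has_derivative
        (\<lambda>v. f x * frechet_derivative g (at x) v + frechet_derivative f (at x) v * g x)) (at x)" for x
      by (intro has_derivative_mult C_k_has_derivative[OF Suc.prems(1)] C_k_has_derivative[OF Suc.prems(2)])
    \<comment> \<open>The product rule leaves undifferentiated factors, which must first be lowered
      from class \<open>Suc k\<close> to class \<open>k\<close>.\<close>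
    show "C_k k (\<lambda>x. f x * frechet_derivative g (at x) v + frechet_derivative f (at x) v * g x)" for v
      using Suc.prems C_k_SucD[OF Suc.prems(1)] C_k_SucD[OF Suc.prems(2)]
      by (intro C_k_add Suc.IH) auto
  qed
qed

lemma C_k_diff: "C_k k f \<Longrightarrow> C_k k g \<Longrightarrow> C_k k (\<lambda>x. f x - g x)"
  using C_k_add[of k f "\<lambda>x. (-1) * g x"] C_k_mult[OF C_k_const[of k "-1"], of g] by simp

lemma C_k_bounded_linear: "bounded_linear L \<Longrightarrow> C_k k L"
proof (induction k)
  case 0
  then show ?case by (simp add: linear_continuous_on)
next
  case (Suc k)
  show ?case
    by (rule C_k_SucI[where D = "\<lambda>_. L"]) (auto intro: bounded_linear_imp_has_derivative Suc.prems C_k_const)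
qed

lemma C_k_frechet_derivative: "C_k (Suc k) f \<Longrightarrow> C_k k (\<lambda>x. frechet_derivative f (at x) v)"
  by simp

section \<open>Functions of one real variable and their composition with |x|^2\<close>

lemma C_k_Suc_realI:
  fixes F :: "real \<Rightarrow> complex"
  assumes "\<And>t. (F has_vector_derivative F' t) (at t)" and "C_k k F'"
  shows "C_k (Suc k) F"
proof (rule C_k_SucI)
  show "(F has_derivative (\<lambda>v. v *\<^sub>R F' t)) (at t)" for t
    using assms(1) by (simp add: has_vector_derivative_def)
  show "C_k k (\<lambda>t. v *\<^sub>R F' t)" for v
    using C_k_mult[OF C_k_const assms(2), of "of_real v"] by (simp add: scaleR_conv_of_real)
qed

lemma C_k_has_vector_derivative:
  fixes F :: "real \<Rightarrow> complex"
  assumes "C_k (Suc k) F"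
  shows "(F has_vector_derivative frechet_derivative F (at t) 1) (at t)"
proof -
  have D: "(F has_derivative frechet_derivative F (at t)) (at t)"
    by (rule C_k_has_derivative[OF assms])
  have "frechet_derivative F (at t) = (\<lambda>v. v *\<^sub>R frechet_derivative F (at t) 1)"
  proof
    show "frechet_derivative F (at t) v = v *\<^sub>R frechet_derivative F (at t) 1" for v
      using linear_scale[OF has_derivative_linear[OF D], of v 1] by simp
  qed
  with D show ?thesis
    by (simp add: has_vector_derivative_def)
qed

lemma C_k_Suc_realE:
  fixes F :: "real \<Rightarrow> complex"
  assumes "C_k (Suc k) F"
  obtains F' where "\<And>t. (F has_vector_derivative F' t) (at t)" and "C_k k F'"
  using C_k_has_vector_derivative[OF assms] C_k_frechet_derivative[OF assms] by (rule that)

lemma C_k_compose_affine: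
  fixes F :: "real \<Rightarrow> complex"
  shows "C_k k F \<Longrightarrow> C_k k (\<lambda>t. F (p * t + q))"
proof (induction k arbitrary: F)
  case 0
  then show ?case
    by (auto intro!: continuous_intros continuous_on_compose2[of UNIV F])
next
  case (Suc k)
  obtain F' where F': "\<And>t. (F has_vector_derivative F' t) (at t)" "C_k k F'"
    using Suc.prems by (rule C_k_Suc_realE) blast
  show ?case
  proof (rule C_k_Suc_realI)
    show "((\<lambda>t. F (p * t + q)) has_vector_derivative of_real p * F' (p * t + q)) (at t)" for t
    proof -
      have "((\<lambda>t. p * t + q) has_vector_derivative p) (at t)"
        by (auto intro!: derivative_eq_intros)
      from vector_diff_chain_at[OF this F'(1)] show ?thesis
        by (simp add: o_def scaleR_conv_of_real)
    qed
    show "C_k k (\<lambda>t. of_real p * F' (p * t + q))"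
      using C_k_mult[OF C_k_const Suc.IH[OF F'(2)]] by simp
  qed
qed

lemma has_derivative_compose_inner:
  fixes G :: "real \<Rightarrow> complex"
  assumes "\<And>q. (G has_vector_derivative G' q) (at q)"
  shows "((\<lambda>x::'a::euclidean_space. G (x \<bullet> x)) has_derivative (\<lambda>v. of_real (2 * (x \<bullet> v)) * G' (x \<bullet> x))) (at x)"
proof -
  have 1: "((\<lambda>x. x \<bullet> x) has_derivative (\<lambda>v. 2 * (x \<bullet> v))) (at x)"
    by (auto intro!: derivative_eq_intros simp: inner_commute)
  have 2: "(G has_derivative (\<lambda>v. v *\<^sub>R G' (x \<bullet> x))) (at (x \<bullet> x))"
    using assms by (simp add: has_vector_derivative_def)
  from diff_chain_at[OF 1 2] show ?thesis
    by (simp add: o_def scaleR_conv_of_real)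
qed

text \<open>Each directional derivative is a linear form times a function of the same shape, so the
  induction closes. The variable |x|^2, unlike |x|, is smooth at the origin.\<close>

lemma C_k_compose_inner:
  fixes G :: "real \<Rightarrow> complex"
  shows "C_k k G \<Longrightarrow> C_k k (\<lambda>x::'a::euclidean_space. G (x \<bullet> x))"
proof (induction k arbitrary: G)
  case 0
  then show ?case
    by (auto intro!: continuous_intros continuous_on_compose2[of UNIV G])
next
  case (Suc k)
  obtain G' where G': "\<And>t. (G has_vector_derivative G' t) (at t)" "C_k k G'"
    using Suc.prems by (rule C_k_Suc_realE) blast
  show ?case
  proof (rule C_k_SucI)
    show "((\<lambda>x. G (x \<bullet> x)) has_derivative (\<lambda>v. of_real (2 * (x \<bullet> v)) * G' (x \<bullet> x))) (at x)" for x :: 'a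
      by (rule has_derivative_compose_inner[OF G'(1)])
    have "bounded_linear (\<lambda>x::'a. complex_of_real (2 * (x \<bullet> v)))" for v
      by (intro bounded_linear_compose[OF bounded_linear_of_real] bounded_linear_const_mult bounded_linear_inner_left)
    then show "C_k k (\<lambda>x::'a. of_real (2 * (x \<bullet> v)) * G' (x \<bullet> x))" for v
      by (rule C_k_mult[OF C_k_bounded_linear Suc.IH[OF G'(2)]])
  qed
qed

subsection \<open>A smooth bump\<close>

text \<open>The polynomial in 1/t makes these flat functions a family closed under differentiation,
  so smoothness follows by one induction over all \<open>p\<close>.\<close>

definition exp_germ :: "real poly \<Rightarrow> real \<Rightarrow> real" where
  "exp_germ p t = (if t > 0 then poly p (1 / t) * exp (- (1 / t)) else 0)"

lemma tendsto_poly_div_exp_0: "((\<lambda>y. poly p y * exp (- y)) \<longlongrightarrow> (0::real)) at_top"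
proof -
  have "(\<Sum>i\<le>degree p. coeff p i * (y ^ i / exp y)) = poly p y * exp (- y)" for y
    by (simp add: poly_altdef sum_divide_distrib exp_minus flip: divide_inverse)
  moreover have "((\<lambda>y. \<Sum>i\<le>degree p. coeff p i * (y ^ i / exp y)) \<longlongrightarrow> (\<Sum>i\<le>degree p. coeff p i * 0)) at_top"
    by (intro tendsto_intros tendsto_power_div_exp_0)
  ultimately show ?thesis
    by simp
qed

lemma exp_germ_tendsto_0: "(exp_germ p \<longlongrightarrow> 0) (at_right 0)"
proof -
  have "((\<lambda>t. poly p (inverse t) * exp (- inverse t)) \<longlongrightarrow> 0) (at_right 0)"
    by (rule filterlim_compose[OF tendsto_poly_div_exp_0 filterlim_inverse_at_top_right])
  then show ?thesis
    by (rule Lim_transform_eventually)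
      (auto simp: exp_germ_def eventually_at_filter inverse_eq_divide)
qed

text \<open>With s = 1/t, the t-derivative of p(s) exp(-s) is s^2 (p(s) - p'(s)) exp(-s); the double
  \<open>pCons 0\<close> is the factor s^2.\<close>

lemma exp_germ_has_derivative:
  "(exp_germ p has_field_derivative exp_germ (pCons 0 (pCons 0 (p - pderiv p))) t) (at t)"
proof -
  consider "t > 0" | "t < 0" | "t = 0" by linarith
  then show ?thesis
  proof cases
    case 1
    have "((\<lambda>t. poly p (1 / t) * exp (- (1 / t))) has_field_derivative
        exp_germ (pCons 0 (pCons 0 (p - pderiv p))) t) (at t)"
      using 1 by (auto intro!: derivative_eq_intros simp: exp_germ_def field_simps power2_eq_square)
    then show ?thesis
      by (rule has_field_derivative_transform_within_open[of _ _ _ "{0<..}"])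
        (use 1 in \<open>auto simp: exp_germ_def\<close>)
  next
    case 2
    have "((\<lambda>t. 0) has_field_derivative 0) (at t)" by simp
    then have "(exp_germ p has_field_derivative 0) (at t)"
      by (rule has_field_derivative_transform_within_open[of _ _ _ "{..<0}"])
        (use 2 in \<open>auto simp: exp_germ_def\<close>)
    then show ?thesis using 2 by (simp add: exp_germ_def)
  next
    case 3
    \<comment> \<open>To the right of 0 the difference quotient is itself the germ of
      \<open>pCons 0 p\<close>, whose limit is known.\<close>
    have "((\<lambda>h. exp_germ p h / h) \<longlongrightarrow> 0) (at_right 0)"
      by (rule Lim_transform_eventually[OF exp_germ_tendsto_0[of "pCons 0 p"]])
        (auto simp: exp_germ_def eventually_at_filter)
    moreover have "((\<lambda>h. exp_germ p h / h) \<longlongrightarrow> 0) (at_left 0)"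
      by (rule Lim_transform_eventually[OF tendsto_const])
        (auto simp: exp_germ_def eventually_at_filter)
    ultimately have "((\<lambda>h. exp_germ p h / h) \<longlongrightarrow> 0) (at 0)"
      by (simp add: filterlim_split_at)
    then show ?thesis
      using 3 by (simp add: DERIV_def exp_germ_def)
  qed
qed

lemma C_k_exp_germ: "C_k k (\<lambda>t. complex_of_real (exp_germ p t))"
proof (induction k arbitrary: p)
  case 0
  have "continuous_on UNIV (exp_germ p)"
    using exp_germ_has_derivative by (meson DERIV_continuous_on has_field_derivative_at_within)
  then show ?case by (auto intro: continuous_intros)
next
  case (Suc k)
  show ?case
    by (rule C_k_Suc_realI[OF _ Suc])
      (rule has_vector_derivative_of_real[OF exp_germ_has_derivative])
qed

text \<open>A flat germ at 0 times a reflected one at 1: smooth, and nonzero exactly on the open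
  unit interval.\<close>

definition bump :: "real \<Rightarrow> complex" where
  "bump t = of_real (exp_germ 1 t * exp_germ 1 (1 - t))"

lemma C_k_bump: "C_k k bump"
proof -
  have "C_k k (\<lambda>t. complex_of_real (exp_germ 1 t) * complex_of_real (exp_germ 1 ((-1) * t + 1)))"
    by (intro C_k_mult C_k_exp_germ C_k_compose_affine[where F = "\<lambda>t. complex_of_real (exp_germ 1 t)"])
  then show ?thesis
    unfolding bump_def[abs_def] by (simp add: algebra_simps)
qed

lemma bump_eq_0: "t \<notin> {0<..<1} \<Longrightarrow> bump t = 0"
  by (auto simp: bump_def exp_germ_def)

text \<open>On the middle half both reciprocals are at most 4. The bound later makes the squared
  norm of a stretched bump grow at least linearly with its length.\<close>

lemma bump_ge: "t \<in> {1/4..3/4} \<Longrightarrow> cmod (bump t) \<ge> exp (- 8)"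
proof -
  assume t: "t \<in> {1/4..3/4}"
  then have "1 / t \<le> 4" "1 / (1 - t) \<le> 4"
    by (auto simp: field_simps)
  then have "exp (- 8) \<le> exp (- (1 / t) + - (1 / (1 - t)))"
    unfolding exp_le_cancel_iff by linarith
  also have "\<dots> = cmod (bump t)"
    using t by (subst exp_add) (simp add: bump_def exp_germ_def norm_mult)
  finally show ?thesis .
qed

subsection \<open>Test functions and weak derivatives\<close>

text \<open>Any compact set outside which \<open>f\<close> vanishes contains the closed support, so
  the support itself need not be computed.\<close>

lemma test_functionsI:
  assumes "\<And>k. C_k k f" and "compact K" and "K \<subseteq> \<Omega>" and "\<And>x. x \<notin> K \<Longrightarrow> f x = 0"
  shows "f \<in> test_functions \<Omega>"
proof -
  have "closure {x. f x \<noteq> 0} \<subseteq> K"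
    using assms(2,4) by (intro closure_minimal) (auto intro: compact_imp_closed)
  then show ?thesis
    using assms by (auto simp: test_functions_def compact_eq_bounded_closed intro: bounded_subset)
qed

lemma test_functionsE:
  assumes "f \<in> test_functions \<Omega>"
  obtains K where "\<And>k. C_k k f" "compact K" "K \<subseteq> \<Omega>" "\<And>x. x \<notin> K \<Longrightarrow> f x = 0"
proof (rule that)
  show "C_k k f" "compact (closure {x. f x \<noteq> 0})" "closure {x. f x \<noteq> 0} \<subseteq> \<Omega>" for k
    using assms by (simp_all add: test_functions_def)
  show "f x = 0" if "x \<notin> closure {x. f x \<noteq> 0}" for x
    using that closure_subset[of "{x. f x \<noteq> 0}"] by auto
qed

lemma test_functions_C_k: "f \<in> test_functions \<Omega> \<Longrightarrow> C_k k f"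
  by (simp add: test_functions_def)

lemma test_functions_continuous: "f \<in> test_functions \<Omega> \<Longrightarrow> continuous_on UNIV f"
  using test_functions_C_k[of f \<Omega> 0] by simp

lemma test_functions_has_derivative:
  "f \<in> test_functions \<Omega> \<Longrightarrow> (f has_derivative frechet_derivative f (at x)) (at x)"
  by (rule C_k_has_derivative[OF test_functions_C_k])

lemma test_functions_mult:
  assumes "f \<in> test_functions \<Omega>" and "\<And>k. C_k k g"
  shows "(\<lambda>x. g x * f x) \<in> test_functions \<Omega>"
  using assms(1)
proof (rule test_functionsE)
  fix K
  assume "\<And>k. C_k k f" "compact K" "K \<subseteq> \<Omega>" "\<And>x. x \<notin> K \<Longrightarrow> f x = 0"
  then show ?thesis
    using assms(2) by (intro test_functionsI[of _ K]) (auto intro: C_k_mult)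
qed

lemma test_functions_add:
  assumes "f \<in> test_functions \<Omega>" and "g \<in> test_functions \<Omega>"
  shows "(\<lambda>x. f x + g x) \<in> test_functions \<Omega>"
proof -
  obtain K where K: "\<And>k. C_k k f" "compact K" "K \<subseteq> \<Omega>" "\<And>x. x \<notin> K \<Longrightarrow> f x = 0"
    using assms(1) by (rule test_functionsE) blast
  obtain K' where K': "\<And>k. C_k k g" "compact K'" "K' \<subseteq> \<Omega>" "\<And>x. x \<notin> K' \<Longrightarrow> g x = 0"
    using assms(2) by (rule test_functionsE) blast
  show ?thesis
    using K K' by (intro test_functionsI[of _ "K \<union> K'"]) (auto intro: C_k_add compact_Un)
qed

lemma test_functions_frechet_derivative:
  assumes "f \<in> test_functions \<Omega>"
  shows "(\<lambda>x. frechet_derivative f (at x) v) \<in> test_functions \<Omega>"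
  using assms
proof (rule test_functionsE)
  fix K
  assume K: "\<And>k. C_k k f" "compact K" "K \<subseteq> \<Omega>" "\<And>x. x \<notin> K \<Longrightarrow> f x = 0"
  show ?thesis
  proof (rule test_functionsI[OF _ K(2,3)])
    fix x
    assume x: "x \<notin> K"
    \<comment> \<open>\<open>K\<close> is closed, so near \<open>x\<close> the function coincides
      with zero.\<close>
    have "((\<lambda>_. 0) has_derivative (\<lambda>_. 0)) (at x)" by simp
    then have "(f has_derivative (\<lambda>_. 0)) (at x)"
      by (rule has_derivative_transform_within_open[of _ _ _ _ "- K"])
        (use x K in \<open>auto simp: compact_imp_closed open_Compl\<close>)
    from frechet_derivative_at[OF this] show "frechet_derivative f (at x) v = 0"
      by metis
  qed (rule C_k_frechet_derivative[OF K(1)])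
qed

lemma test_functions_integrable:
  assumes "f \<in> test_functions \<Omega>"
  shows "integrable lborel f"
  using assms
proof (rule test_functionsE)
  fix K
  assume K: "\<And>k. C_k k f" "compact K" "K \<subseteq> \<Omega>" "\<And>x. x \<notin> K \<Longrightarrow> f x = 0"
  have "integrable lborel (\<lambda>x. indicator K x *\<^sub>R f x)"
    by (rule borel_integrable_compact[OF K(2)])
      (rule continuous_on_subset[OF test_functions_continuous[OF assms]], simp)
  moreover have "(\<lambda>x. indicator K x *\<^sub>R f x) = f"
    using K(4) by (auto simp: indicator_def fun_eq_iff)
  ultimately show ?thesis by simp
qed

lemma test_functions_L2:
  assumes "f \<in> test_functions \<Omega>"
  shows "f \<in> L2"
  using assms
proof (rule test_functionsE)
  fix K
  assume K: "\<And>k. C_k k f" "compact K" "K \<subseteq> \<Omega>" "\<And>x. x \<notin> K \<Longrightarrow> f x = 0"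
  note cont = test_functions_continuous[OF assms]
  have "integrable lborel (\<lambda>x. indicator K x *\<^sub>R (cmod (f x))\<^sup>2)"
    by (rule borel_integrable_compact[OF K(2)])
      (intro continuous_intros continuous_on_subset[OF cont] subset_UNIV)
  moreover have "(\<lambda>x. indicator K x *\<^sub>R (cmod (f x))\<^sup>2) = (\<lambda>x. (cmod (f x))\<^sup>2)"
    using K(4) by (auto simp: indicator_def fun_eq_iff)
  ultimately have "integrable lborel (\<lambda>x. (cmod (f x))\<^sup>2)" by simp
  then show ?thesis
    using cont by (simp add: L2_def borel_measurable_continuous_onI)
qed

lemma test_functions_bounded:
  assumes "f \<in> test_functions \<Omega>"
  obtains M where "\<And>x. cmod (f x) \<le> M"
  using assms
proof (rule test_functionsE)
  fix K
  assume K: "\<And>k. C_k k f" "compact K" "K \<subseteq> \<Omega>" "\<And>x. x \<notin> K \<Longrightarrow> f x = 0"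
  have "bounded (f ` K)"
    using K(2) by (intro compact_imp_bounded compact_continuous_image continuous_on_subset[OF test_functions_continuous[OF assms]]) auto
  then obtain M where "\<And>y. y \<in> f ` K \<Longrightarrow> cmod y \<le> M"
    unfolding bounded_iff by blast
  then have "cmod (f x) \<le> max M 0" for x
    using K(4)[of x] by (cases "x \<in> K") (auto simp: le_max_iff_disj)
  then show thesis by (rule that)
qed

section \<open>Integration by parts for test functions\<close>

lemma integral_lborel_translation:
  fixes f :: "'a::euclidean_space \<Rightarrow> complex"
  assumes "f \<in> borel_measurable borel"
  shows "(LINT x|lborel. f (h + x)) = (LINT x|lborel. f x)"
proof -
  have "(LINT x|lborel. f x) = (LINT x|distr lborel borel ((+) h). f x)"
    by (simp add: lborel_distr_plus)
  also have "\<dots> = (LINT x|lborel. f (h + x))"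
    using assms by (intro integral_distr) auto
  finally show ?thesis by simp
qed

text \<open>The difference quotients have integral zero by translation invariance, and they are dominated
  by a multiple of the indicator function of a compact set.\<close>

lemma integral_frechet_derivative_eq_0:
  fixes f :: "'a::euclidean_space \<Rightarrow> complex"
  assumes f: "f \<in> test_functions \<Omega>"
  shows "(LINT x|lborel. frechet_derivative f (at x) b) = 0"
proof -
  obtain K where K: "compact K" "\<And>x. x \<notin> K \<Longrightarrow> f x = 0"
    using f by (rule test_functionsE) blast
  obtain M where M: "\<And>x. cmod (frechet_derivative f (at x) b) \<le> M"
    using test_functions_bounded[OF test_functions_frechet_derivative[OF f]] by blast
  have D: "(f has_derivative frechet_derivative f (at x)) (at x)" for x
    by (rule test_functions_has_derivative[OF f])
  have f_meas [measurable]: "f \<in> borel_measurable borel"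
    using test_functions_continuous[OF f] by (rule borel_measurable_continuous_onI)
  have f_int: "integrable lborel f"
    by (rule test_functions_integrable[OF f])
  have line: "((\<lambda>t. f (t *\<^sub>R b + x)) has_vector_derivative frechet_derivative f (at (t *\<^sub>R b + x)) b) (at t within S)"
    for x t S
  proof -
    have "((\<lambda>t. t *\<^sub>R b + x) has_derivative (\<lambda>s. s *\<^sub>R b)) (at t within S)"
      by (auto intro!: derivative_eq_intros)
    from has_derivative_compose[OF this D] show ?thesis
      by (simp add: has_vector_derivative_def linear_scale[OF has_derivative_linear[OF D]])
  qed
  \<comment> \<open>Enlarging \<open>K\<close> by a ball of radius \<open>norm b\<close> captures
    the supports of all difference quotients, since the steps \<open>h n\<close> are at most
    1.\<close>
  define K' where "K' = {x + y | x y. x \<in> K \<and> y \<in> cball 0 (norm b)}"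
  have K': "compact K'"
    unfolding K'_def by (intro compact_sums K compact_cball)
  have plus_K': "y + w \<in> K'" if "y \<in> K" "norm w \<le> norm b" for y w
    unfolding K'_def using that by auto
  define h where "h n = inverse (real (Suc n))" for n
  have h: "h n > 0" "h n \<le> 1" for n
    by (auto simp: h_def divide_simps)
  define s where "s n x = (f (h n *\<^sub>R b + x) - f x) /\<^sub>R h n" for n x
  \<comment> \<open>Mean value inequality on the segment from \<open>x\<close> to
    \<open>h n *\<^sub>R b + x\<close>; division by \<open>h n\<close> bounds the quotients
    uniformly by \<open>M\<close>.\<close>
  have lip: "cmod (f (h n *\<^sub>R b + x) - f x) \<le> M * h n" for n x
  proof -
    have "cmod (f (h n *\<^sub>R b + x) - f (0 *\<^sub>R b + x)) \<le> M * norm (h n - 0)"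
    proof (rule differentiable_bound[where S = "{0..h n}"])
      show "((\<lambda>t. f (t *\<^sub>R b + x)) has_derivative (\<lambda>s. s *\<^sub>R frechet_derivative f (at (t *\<^sub>R b + x)) b))
          (at t within {0..h n})" for t
        using line by (simp add: has_vector_derivative_def)
      show "onorm (\<lambda>s. s *\<^sub>R frechet_derivative f (at (t *\<^sub>R b + x)) b) \<le> M" for t
        by (rule onorm_le) (use M in \<open>auto simp: mult.commute[of M] intro: mult_left_mono\<close>)
    qed (use h(1)[of n] in auto)
    then show ?thesis using h(1)[of n] by simp
  qed
  have int_h: "integrable lborel (\<lambda>x. f (h n *\<^sub>R b + x))" for n
    using f_int integrable_distr[of "(+) (h n *\<^sub>R b)" lborel borel f] by (simp add: lborel_distr_plus)
  have "(\<lambda>n. LINT x|lborel. s n x) \<longlonglongrightarrow> (LINT x|lborel. frechet_derivative f (at x) b)"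
  proof (rule integral_dominated_convergence[where w = "\<lambda>x. indicator K' x *\<^sub>R M"])
    show "(\<lambda>x. frechet_derivative f (at x) b) \<in> borel_measurable lborel"
      by (rule borel_measurable_integrable[OF test_functions_integrable[OF test_functions_frechet_derivative[OF f]]])
    show "s n \<in> borel_measurable lborel" for n
      unfolding s_def by measurable
    show "integrable lborel (\<lambda>x. indicator K' x *\<^sub>R M)"
      by (rule borel_integrable_compact[OF K']) simp
    show "AE x in lborel. (\<lambda>n. s n x) \<longlonglongrightarrow> frechet_derivative f (at x) b"
    proof (rule AE_I2)
      fix x
      let ?D = "frechet_derivative f (at x) b"
      have "((\<lambda>t. norm (f (t *\<^sub>R b + x) - f x - t *\<^sub>R ?D) / norm t) \<longlongrightarrow> 0) (at 0)"
        using line[of x 0 UNIV] by (simp add: has_vector_derivative_def has_derivative_at)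
      moreover have "\<forall>\<^sub>F t in at 0. norm (f (t *\<^sub>R b + x) - f x - t *\<^sub>R ?D) / norm t
          = norm ((f (t *\<^sub>R b + x) - f x) /\<^sub>R t - ?D)"
        unfolding eventually_at_filter
      proof (intro always_eventually allI impI)
        fix t :: real
        assume "t \<noteq> 0"
        then have "(f (t *\<^sub>R b + x) - f x) /\<^sub>R t - ?D = (f (t *\<^sub>R b + x) - f x - t *\<^sub>R ?D) /\<^sub>R t"
          by (simp add: scaleR_diff_right)
        then show "norm (f (t *\<^sub>R b + x) - f x - t *\<^sub>R ?D) / norm t = norm ((f (t *\<^sub>R b + x) - f x) /\<^sub>R t - ?D)"
          by (simp only: norm_scaleR) (simp add: divide_inverse_commute)
      qed
      ultimately have "((\<lambda>t. norm ((f (t *\<^sub>R b + x) - f x) /\<^sub>R t - ?D)) \<longlongrightarrow> 0) (at 0)"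
        by (rule Lim_transform_eventually)
      then have "((\<lambda>t. (f (t *\<^sub>R b + x) - f x) /\<^sub>R t) \<longlongrightarrow> ?D) (at 0)"
        by (simp add: LIM_zero_iff tendsto_norm_zero_iff)
      moreover have "filterlim h (at 0) sequentially"
        unfolding h_def filterlim_at using LIMSEQ_inverse_real_of_nat by (auto simp del: of_nat_Suc)
      ultimately show "(\<lambda>n. s n x) \<longlonglongrightarrow> frechet_derivative f (at x) b"
        unfolding s_def using filterlim_compose by fastforce
    qed
    show "AE x in lborel. norm (s n x) \<le> indicator K' x *\<^sub>R M" for n
    proof (rule AE_I2)
      fix x
      show "norm (s n x) \<le> indicator K' x *\<^sub>R M"
      proof (cases "x \<in> K'")
        case True
        have "norm (s n x) = cmod (f (h n *\<^sub>R b + x) - f x) / h n"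
          unfolding s_def norm_scaleR using h(1)[of n] by (simp add: divide_inverse_commute)
        also have "\<dots> \<le> M"
          using lip[of n x] h(1)[of n] by (simp add: pos_divide_le_eq)
        finally show ?thesis
          using True by simp
      next
        case False
        have "x \<notin> K"
        proof
          assume "x \<in> K"
          from plus_K'[OF this, of 0] have "x \<in> K'" by simp
          with False show False by simp
        qed
        moreover have "h n *\<^sub>R b + x \<notin> K"
        proof
          assume *: "h n *\<^sub>R b + x \<in> K"
          have "norm (- (h n *\<^sub>R b)) \<le> norm b"
            using h[of n] by (simp add: mult_left_le_one_le)
          from plus_K'[OF * this] False show False by simp
        qed
        ultimately show ?thesis
          using K(2) False by (simp add: s_def)
      qed
    qed
  qed
  moreover have "(LINT x|lborel. s n x) = 0" for n
  proof -
    have "(LINT x|lborel. s n x) = ((LINT x|lborel. f (h n *\<^sub>R b + x)) - (LINT x|lborel. f x)) /\<^sub>R h n"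
      unfolding s_def using int_h f_int by simp
    then show ?thesis
      using integral_lborel_translation[OF f_meas] by simp
  qed
  ultimately show ?thesis
    by (simp add: LIMSEQ_const_iff)
qed

text \<open>Integration by parts: the product of \<open>u\<close> with a test function is a test
  function, so the integral of its derivative vanishes.\<close>

lemma weak_deriv_test_function:
  assumes u: "u \<in> test_functions \<Omega>"
  shows "weak_deriv b u (\<lambda>x. frechet_derivative u (at x) b)"
  unfolding weak_deriv_def
proof
  fix \<phi> :: "'a \<Rightarrow> complex"
  assume \<phi>: "\<phi> \<in> test_functions UNIV"
  have D: "frechet_derivative (\<lambda>x. u x * \<phi> x) (at x) b
      = u x * frechet_derivative \<phi> (at x) b + frechet_derivative u (at x) b * \<phi> x" for x
    using frechet_derivative_at[OF has_derivative_mult[OF test_functions_has_derivative[OF u] test_functions_has_derivative[OF \<phi>]], of x]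
    by metis
  have "integrable lborel (\<lambda>x. u x * frechet_derivative \<phi> (at x) b)"
    by (rule test_functions_integrable[OF test_functions_mult[OF test_functions_frechet_derivative[OF \<phi>] test_functions_C_k[OF u]]])
  moreover have "integrable lborel (\<lambda>x. frechet_derivative u (at x) b * \<phi> x)"
    by (rule test_functions_integrable[OF test_functions_mult[OF \<phi>
            test_functions_C_k[OF test_functions_frechet_derivative[OF u]]]])
  moreover have "(LINT x|lborel. frechet_derivative (\<lambda>x. u x * \<phi> x) (at x) b) = 0"
    by (rule integral_frechet_derivative_eq_0[OF test_functions_mult[OF \<phi> test_functions_C_k[OF u]]])
  ultimately show "(LINT x|lborel. u x * frechet_derivative \<phi> (at x) b)
      = - (LINT x|lborel. frechet_derivative u (at x) b * \<phi> x)"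
    unfolding D by (simp add: add_eq_0_iff)
qed

lemma test_functions_H1: "u \<in> test_functions \<Omega> \<Longrightarrow> u \<in> H1"
  unfolding H1_def
  using weak_deriv_test_function test_functions_L2[OF test_functions_frechet_derivative] test_functions_L2
  by blast

lemma test_functions_H2: "u \<in> test_functions \<Omega> \<Longrightarrow> u \<in> H2"
  unfolding H2_def
  using weak_deriv_test_function test_functions_H1[OF test_functions_frechet_derivative] test_functions_L2
  by blast

text \<open>The derivatives enter through formulas \<open>g\<close> and \<open>h\<close> supplied
  from outside, so that explicit radial expressions can be plugged in.\<close>

lemma neg_laplacian_test_function:
  fixes u :: "'a::euclidean_space \<Rightarrow> complex"
  assumes u: "u \<in> test_functions \<Omega>"
    and D1: "\<And>b x. b \<in> Basis \<Longrightarrow> frechet_derivative u (at x) b = g b x"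
    and D2: "\<And>b x. b \<in> Basis \<Longrightarrow> frechet_derivative (g b) (at x) b = h b x"
    and v: "v \<in> L2" "\<And>x. v x = - (\<Sum>b\<in>Basis. h b x)"
  shows "(u, v) \<in> neg_laplacian"
proof -
  have g: "g b \<in> test_functions \<Omega>" if "b \<in> Basis" for b
    using test_functions_frechet_derivative[OF u, of b] by (simp add: D1 that)
  have h: "h b \<in> test_functions \<Omega>" if "b \<in> Basis" for b
    using test_functions_frechet_derivative[OF g[OF that], of b] by (simp add: D2 that)
  have "g b \<in> H1 \<and> h b \<in> L2 \<and> weak_deriv b u (g b) \<and> weak_deriv b (g b) (h b)" if "b \<in> Basis" for b
    using weak_deriv_test_function[OF u, of b] weak_deriv_test_function[OF g[OF that], of b]
      test_functions_H1[OF g[OF that]] test_functions_L2[OF h[OF that]]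
    by (simp add: D1 D2 that)
  then show ?thesis
    unfolding neg_laplacian_def using test_functions_H2[OF u] v by auto
qed

subsection \<open>Radial functions\<close>

text \<open>Here q stands for |x|^2: a profile \<open>F\<close> on the logarithmic scale with weight
  |x|^(2 \<alpha>). The value 0 for q \<le> 0 continues it smoothly when \<open>F\<close> is smooth
  and vanishes near minus infinity.\<close>

definition radial :: "real \<Rightarrow> (real \<Rightarrow> complex) \<Rightarrow> real \<Rightarrow> complex" where
  "radial \<alpha> F q = (if q > 0 then of_real (q powr \<alpha>) * F (ln q) else 0)"

lemma radial_pos: "q > 0 \<Longrightarrow> radial \<alpha> F q = of_real (q powr \<alpha>) * F (ln q)"
  by (simp add: radial_def)

lemma radial_eq_0:
  assumes "\<And>t. t < A \<Longrightarrow> F t = 0" and "q < exp A"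
  shows "radial \<alpha> F q = 0"
proof (cases "q > 0")
  case True
  then have "ln q < A"
    using assms(2) ln_less_cancel_iff[of q "exp A"] by simp
  then show ?thesis
    by (simp add: radial_def assms(1))
qed (simp add: radial_def)

lemma has_vector_derivative_eq_0:
  assumes "(F has_vector_derivative y) (at t)" and "open S" and "t \<in> S" and "\<And>s. s \<in> S \<Longrightarrow> F s = 0"
  shows "y = 0"
proof -
  have "((\<lambda>_. 0) has_vector_derivative 0) (at t)" by simp
  then have "(F has_vector_derivative 0) (at t)"
    by (rule has_vector_derivative_transform_within_open[of _ _ _ S]) (use assms in auto)
  with assms(1) show ?thesis
    by (rule vector_derivative_unique_at)
qed

text \<open>As ln has derivative 1/q, both terms of the product rule carry the same power of q.
  Hence \<open>radial\<close> functions are closed under differentiation, which drives the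
  smoothness induction.\<close>

lemma radial_has_vector_derivative:
  assumes F: "\<And>t. (F has_vector_derivative F' t) (at t)" and supp: "\<And>t. t < A \<Longrightarrow> F t = 0"
  shows "(radial \<alpha> F has_vector_derivative radial (\<alpha> - 1) (\<lambda>t. of_real \<alpha> * F t + F' t) q) (at q)"
proof (cases "q > 0")
  case True
  have "((\<lambda>q. q powr \<alpha>) has_field_derivative \<alpha> * q powr (\<alpha> - 1)) (at q)"
    using True by (auto intro!: derivative_eq_intros)
  then have 1: "((\<lambda>q. complex_of_real (q powr \<alpha>)) has_vector_derivative of_real (\<alpha> * q powr (\<alpha> - 1))) (at q)"
    by (rule has_vector_derivative_of_real)
  have "(ln has_vector_derivative 1 / q) (at q)"
    using DERIV_ln_divide[OF True] by (simp add: has_real_derivative_iff_has_vector_derivative)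
  from vector_diff_chain_at[OF this F] have 2: "((\<lambda>q. F (ln q)) has_vector_derivative of_real (1 / q) * F' (ln q)) (at q)"
    by (simp add: o_def scaleR_conv_of_real)
  have "q powr \<alpha> * (1 / q) = q powr (\<alpha> - 1)"
    using True by (simp add: powr_diff)
  then have "complex_of_real (q powr \<alpha>) * of_real (1 / q) = of_real (q powr (\<alpha> - 1))"
    by (simp flip: of_real_mult del: of_real_divide)
  then have "of_real (q powr \<alpha>) * (of_real (1 / q) * F' (ln q)) + of_real (\<alpha> * q powr (\<alpha> - 1)) * F (ln q)
      = of_real (q powr (\<alpha> - 1)) * (of_real \<alpha> * F (ln q) + F' (ln q))"
    unfolding mult.assoc[symmetric] by (simp add: algebra_simps)
  with has_vector_derivative_mult[OF 1 2]
  have "((\<lambda>q. of_real (q powr \<alpha>) * F (ln q)) has_vector_derivative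
      radial (\<alpha> - 1) (\<lambda>t. of_real \<alpha> * F t + F' t) q) (at q)"
    using True by (simp add: radial_pos)
  then show ?thesis
    by (rule has_vector_derivative_transform_within_open[of _ _ _ "{0<..}"])
      (use True in \<open>auto simp: radial_pos\<close>)
next
  case False
  \<comment> \<open>A point q \<le> 0 lies in the open set q < \<open>exp A\<close>, where the
    function vanishes identically.\<close>
  have "((\<lambda>_. 0) has_vector_derivative (0::complex)) (at q)" by simp
  then have "(radial \<alpha> F has_vector_derivative 0) (at q)"
    by (rule has_vector_derivative_transform_within_open[of _ _ _ "{..<exp A}"])
      (use False in \<open>auto simp: radial_eq_0[OF supp] intro: le_less_trans[OF _ exp_gt_zero]\<close>)
  with False show ?thesis
    by (simp add: radial_def)
qed

lemma C_k_radial: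
  assumes "C_k k F" and "\<And>t. t < A \<Longrightarrow> F t = 0"
  shows "C_k k (radial \<alpha> F)"
  using assms
proof (induction k arbitrary: F \<alpha>)
  case 0
  have "continuous_on {0<..} (\<lambda>q. of_real (q powr \<alpha>) * F (ln q))"
    using 0(1) by (auto intro!: continuous_intros continuous_on_compose2[of UNIV F])
  then have 1: "continuous_on {0<..} (radial \<alpha> F)"
    by (rule continuous_on_cong[THEN iffD1, rotated -1]) (auto simp: radial_pos)
  have "continuous_on {..<exp A} (\<lambda>q. 0 :: complex)" by simp
  then have 2: "continuous_on {..<exp A} (radial \<alpha> F)"
    by (rule continuous_on_cong[THEN iffD1, rotated -1]) (auto simp: radial_eq_0[OF 0(2)])
  have "continuous_on ({0<..} \<union> {..<exp A}) (radial \<alpha> F)"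
    using 1 2 by (intro continuous_on_open_Un) auto
  moreover have "{0<..} \<union> {..<exp A} = UNIV"
    using exp_gt_zero[of A] by (auto simp: not_less intro: le_less_trans)
  ultimately show ?case by simp
next
  case (Suc k)
  obtain F' where F': "\<And>t. (F has_vector_derivative F' t) (at t)" "C_k k F'"
    using Suc.prems(1) by (rule C_k_Suc_realE) blast
  have F'_0: "F' t = 0" if "t < A" for t
    using has_vector_derivative_eq_0[OF F'(1), of "{..<A}" t] that Suc.prems(2) by simp
  show ?case
  proof (rule C_k_Suc_realI)
    show "(radial \<alpha> F has_vector_derivative radial (\<alpha> - 1) (\<lambda>t. of_real \<alpha> * F t + F' t) q) (at q)" for q
      by (rule radial_has_vector_derivative[OF F'(1) Suc.prems(2)])
    show "C_k k (radial (\<alpha> - 1) (\<lambda>t. of_real \<alpha> * F t + F' t))"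
      by (rule Suc.IH) (auto intro!: C_k_add C_k_mult C_k_const F'(2) C_k_SucD[OF Suc.prems(1)] simp: Suc.prems(2) F'_0)
  qed
qed

text \<open>The support of \<open>F\<close> confines the function to the closed shell
  \<open>exp A\<close> \<le> |x|^2 \<le> \<open>exp B\<close>, which is compact and avoids the
  origin.\<close>

lemma radial_test_function:
  fixes \<alpha> :: real
  assumes F: "\<And>k. C_k k F" and supp: "\<And>t. t \<notin> {A..B} \<Longrightarrow> F t = 0"
  shows "(\<lambda>x::'a::euclidean_space. radial \<alpha> F (x \<bullet> x)) \<in> test_functions (UNIV - {0})"
proof (rule test_functionsI)
  let ?K = "{x::'a. x \<bullet> x \<in> {exp A..exp B}}"
  show "C_k k (\<lambda>x::'a. radial \<alpha> F (x \<bullet> x))" for k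
    by (intro C_k_compose_inner C_k_radial[of _ _ A] F supp) auto
  have "closed ((\<lambda>x::'a. x \<bullet> x) -` {exp A..exp B})"
    by (intro closed_vimage continuous_intros closed_atLeastAtMost)
  moreover have "bounded ?K"
  proof (rule boundedI)
    fix x
    assume "x \<in> ?K"
    then have "(norm x)\<^sup>2 \<le> (exp (B / 2))\<^sup>2"
      by (simp add: power2_norm_eq_inner flip: exp_double)
    then show "norm x \<le> exp (B / 2)"
      by (rule power2_le_imp_le) simp
  qed
  ultimately show "compact ?K"
    by (simp add: compact_eq_bounded_closed vimage_def)
  show "?K \<subseteq> UNIV - {0}"
    by (auto simp: not_le)
  show "radial \<alpha> F (x \<bullet> x) = 0" if "x \<notin> ?K" for x
  proof (cases "x = 0")
    case False
    then have "exp (ln (x \<bullet> x)) = x \<bullet> x" by simp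
    with that have "ln (x \<bullet> x) \<notin> {A..B}"
      by (metis (mono_tags, lifting) atLeastAtMost_iff exp_le_cancel_iff mem_Collect_eq)
    then show ?thesis
      by (simp add: radial_def supp)
  qed (simp add: radial_def)
qed

section \<open>The Laplacian and the sandwiched resolvent on radial functions\<close>

lemma frechet_derivative_linear_times_compose_inner:
  fixes b :: "'a::euclidean_space" and G :: "real \<Rightarrow> complex"
  assumes "\<And>q. (G has_vector_derivative G' q) (at q)"
  shows "frechet_derivative (\<lambda>x. of_real (2 * (x \<bullet> b)) * G (x \<bullet> x)) (at x) v
    = of_real (2 * (v \<bullet> b)) * G (x \<bullet> x) + of_real (4 * (x \<bullet> b) * (x \<bullet> v)) * G' (x \<bullet> x)"
proof -
  have "((\<lambda>x. complex_of_real (2 * (x \<bullet> b))) has_derivative (\<lambda>v. of_real (2 * (v \<bullet> b)))) (at x)"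
    by (intro has_derivative_of_real) (auto intro!: derivative_eq_intros)
  from has_derivative_mult[OF this has_derivative_compose_inner[OF assms]]
  show ?thesis
    by (subst frechet_derivative_at[symmetric], assumption) (simp add: algebra_simps)
qed

text \<open>On radial functions \<open>\<bar>x\<bar>\<^sup>2\<^sup>\<alpha> F (ln \<bar>x\<bar>\<^sup>2)\<close> with this exponent, the first order term of the
  Laplacian cancels.\<close>

lemma neg_laplacian_radial:
  fixes F F' F'' :: "real \<Rightarrow> complex"
  defines "n \<equiv> real DIM('a)"
  defines "\<alpha> \<equiv> (2 - n) / 4"
  assumes C: "\<And>k. C_k k F" "\<And>k. C_k k F''"
    and F: "\<And>t. (F has_vector_derivative F' t) (at t)"
    and F': "\<And>t. (F' has_vector_derivative F'' t) (at t)"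
    and supp: "\<And>t. t \<notin> {A..B} \<Longrightarrow> F t = 0" "\<And>t. t \<notin> {A..B} \<Longrightarrow> F'' t = 0"
  shows "((\<lambda>x::'a::euclidean_space. radial \<alpha> F (x \<bullet> x)),
      (\<lambda>x. radial (\<alpha> - 1) (\<lambda>t. of_real ((n / 2 - 1)\<^sup>2) * F t - 4 * F'' t) (x \<bullet> x))) \<in> neg_laplacian"
proof -
  \<comment> \<open>\<open>F1\<close> and \<open>F2\<close> are the profiles of the first and second
    q-derivatives, with exponents \<alpha> - 1 and \<alpha> - 2.\<close>
  define F1 where "F1 t = of_real \<alpha> * F t + F' t" for t
  define F1' where "F1' t = of_real \<alpha> * F' t + F'' t" for t
  define F2 where "F2 t = of_real (\<alpha> - 1) * F1 t + F1' t" for t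
  have F1: "(F1 has_vector_derivative F1' t) (at t)" for t
    unfolding F1_def F1'_def by (intro derivative_intros F F')
  have F'_0: "F' t = 0" if "t < A" for t
    using has_vector_derivative_eq_0[OF F, of "{..<A}" t] that supp(1) by simp
  have G: "(radial \<alpha> F has_vector_derivative radial (\<alpha> - 1) F1 q) (at q)" for q
    unfolding F1_def by (rule radial_has_vector_derivative[OF F, of A]) (simp add: supp(1))
  have G1: "(radial (\<alpha> - 1) F1 has_vector_derivative radial (\<alpha> - 2) F2 q) (at q)" for q
    using radial_has_vector_derivative[OF F1, of A "\<alpha> - 1" q]
    by (simp add: F1_def F2_def[abs_def] supp(1) F'_0)
  have L: "C_k k (\<lambda>t. of_real ((n / 2 - 1)\<^sup>2) * F t - 4 * F'' t)" for k
    by (intro C_k_diff C_k_mult C_k_const C)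
  show ?thesis
  proof (rule neg_laplacian_test_function)
    show "(\<lambda>x::'a. radial \<alpha> F (x \<bullet> x)) \<in> test_functions (UNIV - {0})"
      by (rule radial_test_function[OF C(1) supp(1)])
    show "(\<lambda>x::'a. radial (\<alpha> - 1) (\<lambda>t. of_real ((n / 2 - 1)\<^sup>2) * F t - 4 * F'' t) (x \<bullet> x)) \<in> L2"
      by (rule test_functions_L2[OF radial_test_function[OF L, of A B]]) (simp add: supp)
    show "frechet_derivative (\<lambda>x::'a. radial \<alpha> F (x \<bullet> x)) (at x) b
        = of_real (2 * (x \<bullet> b)) * radial (\<alpha> - 1) F1 (x \<bullet> x)" for b x
      by (simp add: frechet_derivative_at[OF has_derivative_compose_inner[OF G], symmetric])
    show "frechet_derivative (\<lambda>x::'a. of_real (2 * (x \<bullet> b)) * radial (\<alpha> - 1) F1 (x \<bullet> x)) (at x) b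
        = 2 * radial (\<alpha> - 1) F1 (x \<bullet> x) + of_real (4 * ((x \<bullet> b) * (x \<bullet> b))) * radial (\<alpha> - 2) F2 (x \<bullet> x)"
      if "b \<in> Basis" for b x
      using that by (subst frechet_derivative_linear_times_compose_inner[OF G1]) simp
    show "radial (\<alpha> - 1) (\<lambda>t. of_real ((n / 2 - 1)\<^sup>2) * F t - 4 * F'' t) (x \<bullet> x)
        = - (\<Sum>b\<in>Basis. 2 * radial (\<alpha> - 1) F1 (x \<bullet> x)
            + of_real (4 * ((x \<bullet> b) * (x \<bullet> b))) * radial (\<alpha> - 2) F2 (x \<bullet> x))" (is "?l = - ?r") for x :: 'a
    proof -
      define q where "q = x \<bullet> x"
      \<comment> \<open>Summation over the basis produces the Laplacian 2 n G' + 4 q G'' of a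
        function G of q = |x|^2.\<close>
      have "(\<Sum>b\<in>Basis. complex_of_real (4 * ((x \<bullet> b) * (x \<bullet> b)))) = of_real (4 * q)"
        unfolding q_def euclidean_inner[of x x] by (simp add: sum_distrib_left)
      then have r: "?r = of_real (2 * n) * radial (\<alpha> - 1) F1 q + of_real (4 * q) * radial (\<alpha> - 2) F2 q"
        by (simp add: sum.distrib n_def q_def flip: sum_distrib_right)
      show ?thesis
      proof (cases "q > 0")
        case True
        define p where "p = complex_of_real (q powr (\<alpha> - 1))"
        have "q * q powr (\<alpha> - 2) = q powr (\<alpha> - 1)"
          using True powr_mult_base[of q "\<alpha> - 2"] by simp
        then have "of_real q * complex_of_real (q powr (\<alpha> - 2)) = p"
          by (simp add: p_def flip: of_real_mult)
        then have "?r = p * (of_real (2 * n) * F1 (ln q) + 4 * F2 (ln q))"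
          unfolding r using True by (simp add: radial_pos p_def algebra_simps)
        also have "of_real (2 * n) * F1 (ln q) + 4 * F2 (ln q)
            = of_real (2 * n * \<alpha> + 4 * (\<alpha> - 1) * \<alpha>) * F (ln q)
              + of_real (2 * n + 4 * (\<alpha> - 1) + 4 * \<alpha>) * F' (ln q) + 4 * F'' (ln q)"
          by (simp add: F1_def F2_def F1'_def algebra_simps)
        \<comment> \<open>The choice \<alpha> = (2 - n) / 4 removes the \<open>F'\<close> term and
          turns the coefficient of \<open>F\<close> into minus the Hardy constant.\<close>
        also have "2 * n + 4 * (\<alpha> - 1) + 4 * \<alpha> = 0"
          by (simp add: \<alpha>_def field_simps)
        also have "2 * n * \<alpha> + 4 * (\<alpha> - 1) * \<alpha> = - ((n / 2 - 1)\<^sup>2)"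
          by (simp add: \<alpha>_def power2_eq_square field_simps)
        finally show ?thesis
          using True by (simp add: radial_pos p_def q_def[symmetric] algebra_simps)
      next
        case False
        then show ?thesis unfolding r by (simp add: radial_def flip: q_def)
      qed
    qed
  qed
qed

text \<open>The resolvent is never computed: \<open>u\<close> is prescribed, \<open>w\<close> is
  (-\<Delta> - z) applied to \<open>u\<close>, and \<open>f\<close> is |x| times \<open>w\<close>.
  Then \<open>f\<close>, \<open>w\<close>, \<open>u\<close>, \<open>g\<close> is a chain through the
  three factors.\<close>

lemma sandwiched_resolvent_radial:
  fixes F F' F'' :: "real \<Rightarrow> complex" and z :: complex
  defines "n \<equiv> real DIM('a)"
  assumes C: "\<And>k. C_k k F" "\<And>k. C_k k F''"
    and F: "\<And>t. (F has_vector_derivative F' t) (at t)"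
    and F': "\<And>t. (F' has_vector_derivative F'' t) (at t)"
    and supp: "\<And>t. t \<notin> {A..B} \<Longrightarrow> F t = 0" "\<And>t. t \<notin> {A..B} \<Longrightarrow> F'' t = 0"
  shows "((\<lambda>x::'a::euclidean_space. radial (- n / 4) (\<lambda>t. of_real ((n / 2 - 1)\<^sup>2) * F t - 4 * F'' t) (x \<bullet> x)
            - z * radial (1 - n / 4) F (x \<bullet> x)),
          (\<lambda>x. radial (- n / 4) F (x \<bullet> x))) \<in> sandwiched_resolvent z"
proof -
  define H where "H t = of_real ((n / 2 - 1)\<^sup>2) * F t - 4 * F'' t" for t
  define u where "u x = radial ((2 - n) / 4) F (x \<bullet> x)" for x :: 'a
  define v where "v x = radial ((2 - n) / 4 - 1) H (x \<bullet> x)" for x :: 'a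
  define w where "w x = v x - z * u x" for x
  define f where "f x = radial (- n / 4) H (x \<bullet> x) - z * radial (1 - n / 4) F (x \<bullet> x)" for x :: 'a
  define g where "g x = radial (- n / 4) F (x \<bullet> x)" for x :: 'a
  have H: "C_k k H" "t \<notin> {A..B} \<Longrightarrow> H t = 0" for k t
    unfolding H_def[abs_def] by (intro C_k_diff C_k_mult C_k_const C) (simp add: supp)
  have test: "(\<lambda>x::'a. radial \<beta> H (x \<bullet> x) - z * radial \<gamma> F (x \<bullet> x)) \<in> test_functions (UNIV - {0})" for \<beta> \<gamma>
  proof -
    have "(\<lambda>x::'a. - z * radial \<gamma> F (x \<bullet> x)) \<in> test_functions (UNIV - {0})"
      by (rule test_functions_mult[OF radial_test_function[OF C(1) supp(1)] C_k_const])
    from test_functions_add[OF radial_test_function[OF H, where \<alpha> = \<beta>] this] show ?thesis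
      by simp
  qed
  have f: "f \<in> test_functions (UNIV - {0})" and w: "w \<in> test_functions (UNIV - {0})"
    unfolding f_def[abs_def] w_def[abs_def] v_def u_def by (rule test)+
  have L2: "(\<lambda>x::'a. radial \<beta> F (x \<bullet> x)) \<in> L2" for \<beta>
    by (rule test_functions_L2[OF radial_test_function[OF C(1) supp(1)]])
  have u: "u \<in> L2" and g: "g \<in> L2"
    unfolding u_def[abs_def] g_def[abs_def] by (rule L2)+
  \<comment> \<open>Multiplication by 1/|x| = q^(-1/2) lowers the exponent by 1/2.\<close>
  have norm_shift: "radial (\<beta> - 1/2) K (x \<bullet> x) = of_real (inverse (norm x)) * radial \<beta> K (x \<bullet> x)" for \<beta> K and x :: 'a
  proof (cases "x = 0")
    case False
    have "(x \<bullet> x) powr (\<beta> - 1/2) = inverse (norm x) * (x \<bullet> x) powr \<beta>"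
      unfolding powr_diff powr_half_sqrt[OF inner_ge_zero] norm_eq_sqrt_inner[symmetric]
      by (simp add: divide_inverse_commute)
    with False show ?thesis
      by (simp add: radial_pos)
  qed (simp add: radial_def)
  have e: "(2 - n) / 4 - 1 = - n / 4 - 1 / 2" "(2 - n) / 4 = (1 - n / 4) - 1 / 2"
    by (simp_all add: field_simps)
  have v: "v x = of_real (inverse (norm x)) * radial (- n / 4) H (x \<bullet> x)" for x
    unfolding v_def e(1) by (rule norm_shift)
  have "u x = of_real (inverse (norm x)) * radial (1 - n / 4) F (x \<bullet> x)" for x
    unfolding u_def e(2) by (rule norm_shift)
  then have "w x = of_real (inverse (norm x)) * f x" for x
    by (simp add: w_def v f_def algebra_simps)
  then have 1: "(f, w) \<in> mult_operator (\<lambda>x. inverse (norm x))"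
    using test_functions_L2[OF f] test_functions_L2[OF w] by (simp add: mult_operator_def)
  have "g x = of_real (inverse (norm x)) * u x" for x
    using norm_shift[of "(2 - n) / 4" F x]
    by (simp add: u_def g_def diff_divide_distrib)
  then have 2: "(u, g) \<in> mult_operator (\<lambda>x. inverse (norm x))"
    using u g by (simp add: mult_operator_def)
  have "(u, v) \<in> neg_laplacian"
    unfolding u_def[abs_def] v_def[abs_def] H_def[abs_def] n_def
    by (rule neg_laplacian_radial[OF C F F' supp])
  then have 3: "(w, u) \<in> resolvent neg_laplacian z"
    using test_functions_L2[OF w] by (auto simp: resolvent_def minus_scalar_def w_def)
  show ?thesis
    unfolding sandwiched_resolvent_def
    using f 1 2 3 by (auto simp: f_def[abs_def] g_def[abs_def] H_def[abs_def])
qed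

subsection \<open>Dilation invariance of \<open>\<bar>x\<bar>\<^sup>-\<^sup>d dx\<close>\<close>

text \<open>The dilation invariant density |x|^(-d), cut to a window of ln |x|^2. Half-open windows
  let adjacent shells add up exactly; at the origin \<open>powr\<close> gives 0.\<close>

definition shell :: "real \<Rightarrow> real \<Rightarrow> 'a::euclidean_space \<Rightarrow> real" where
  "shell a b x = indicator {a..<b} (ln (x \<bullet> x)) * (x \<bullet> x) powr (- real DIM('a) / 2)"

lemma integral_lborel_scale:
  fixes f :: "'a::euclidean_space \<Rightarrow> real"
  assumes [measurable]: "f \<in> borel_measurable borel" and "c > 0"
  shows "(LINT x|lborel. f x) = c ^ DIM('a) * (LINT x|lborel. f (c *\<^sub>R x))"
proof -
  have "(LINT x|lborel. f x) = (LINT x|density (distr lborel borel (\<lambda>x::'a. 0 + c *\<^sub>R x)) (\<lambda>_. ennreal (c ^ DIM('a))). f x)"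
    using lborel_affine[of c "0::'a"] assms(2) by simp
  also have "\<dots> = (LINT x|distr lborel borel (\<lambda>x::'a. 0 + c *\<^sub>R x). c ^ DIM('a) * f x)"
    using assms(2) by (subst integral_density) auto
  also have "\<dots> = (LINT x|lborel. c ^ DIM('a) * f (c *\<^sub>R x))"
    by (subst integral_distr) auto
  finally show ?thesis by simp
qed

lemma shell_measurable [measurable]: "shell a b \<in> borel_measurable borel"
  unfolding shell_def[abs_def] by measurable

lemma shell_nonneg: "shell a b x \<ge> 0"
  by (simp add: shell_def)

text \<open>The window bounds |x| from above, and the weight is largest at the inner edge |x|^2 =
  \<open>exp a\<close>; a constant on a ball dominates.\<close>

lemma integrable_shell: "integrable lborel (shell a b :: 'a::euclidean_space \<Rightarrow> real)"
proof (rule Bochner_Integration.integrable_bound)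
  let ?K = "cball (0::'a) (exp (b / 2))"
  show "integrable lborel (\<lambda>x::'a. indicator ?K x *\<^sub>R exp (a * (- real DIM('a) / 2)))"
    by (rule borel_integrable_compact) auto
  have "shell a b x \<le> indicator ?K x *\<^sub>R exp (a * (- real DIM('a) / 2))" for x :: 'a
  proof (cases "x \<noteq> 0 \<and> ln (x \<bullet> x) \<in> {a..<b}")
    case True
    define t where "t = ln (x \<bullet> x)"
    have q: "x \<bullet> x = exp t"
      using True by (simp add: t_def)
    have "(norm x)\<^sup>2 \<le> (exp (b / 2))\<^sup>2"
      using True by (simp add: power2_norm_eq_inner q flip: exp_double)
    then have "norm x \<le> exp (b / 2)"
      by (rule power2_le_imp_le) simp
    moreover have "exp (t * (- real DIM('a) / 2)) \<le> exp (a * (- real DIM('a) / 2))"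
      using True by (auto simp: q intro: mult_right_mono_neg)
    ultimately show ?thesis
      using True by (simp add: shell_def q powr_def)
  qed (auto simp: shell_def)
  then show "AE x::'a in lborel. norm (shell a b x) \<le> norm (indicator ?K x *\<^sub>R exp (a * (- real DIM('a) / 2)))"
    by (intro AE_I2) (simp add: shell_nonneg)
qed simp

text \<open>Dilation by exp(s/2) moves ln |x|^2 by s, and its Jacobian cancels against the change of
  the weight.\<close>

lemma integral_shell_shift:
  "(LINT x|lborel. shell (a + s) (b + s) (x::'a::euclidean_space)) = (LINT x|lborel. shell a b (x::'a))"
proof -
  define c where "c = exp (s / 2)"
  have "c ^ DIM('a) * shell (a + s) (b + s) (c *\<^sub>R x) = shell a b x" for x :: 'a
  proof (cases "x = 0")
    case False
    have q: "(c *\<^sub>R x) \<bullet> (c *\<^sub>R x) = exp s * (x \<bullet> x)"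
      by (simp add: c_def flip: exp_add)
    have "ln (exp s * (x \<bullet> x)) = ln (x \<bullet> x) + s"
      using False by (simp add: ln_mult)
    moreover have "c ^ DIM('a) * (exp s * (x \<bullet> x)) powr (- real DIM('a) / 2) = (x \<bullet> x) powr (- real DIM('a) / 2)"
      by (simp add: c_def powr_mult powr_def[of "exp s"] flip: exp_of_nat_mult)
        (simp add: mult.assoc[symmetric] flip: exp_add)
    ultimately show ?thesis
      unfolding shell_def q by (auto simp: indicator_def)
  qed (simp add: shell_def)
  with integral_lborel_scale[of "shell (a + s) (b + s) :: 'a \<Rightarrow> real" c] show ?thesis
    by (simp add: c_def flip: integral_mult_right_zero)
qed

text \<open>By shift invariance every unit window has the same mass, so windows are cut into unit
  pieces.\<close>

lemma integral_shell_of_nat: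
  "(LINT x|lborel. shell a (a + real k) (x::'a::euclidean_space)) = real k * (LINT x|lborel. shell 0 1 (x::'a))"
proof (induction k)
  case 0
  then show ?case by (simp add: shell_def)
next
  case (Suc k)
  have "(LINT x|lborel. shell a (a + real (Suc k)) (x::'a))
      = (LINT x|lborel. shell a (a + real k) (x::'a) + shell (0 + (a + real k)) (1 + (a + real k)) x)"
    by (rule Bochner_Integration.integral_cong) (auto simp: shell_def indicator_def)
  also have "\<dots> = real (Suc k) * (LINT x|lborel. shell 0 1 (x::'a))"
    by (subst Bochner_Integration.integral_add[OF integrable_shell integrable_shell])
      (simp add: Suc integral_shell_shift[of 0 "a + real k" 1, where 'a = 'a, simplified] algebra_simps)
  finally show ?case .
qed

text \<open>Zero integral would force the function to vanish almost everywhere, but it is positive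
  on the nonempty open set 1 < |x|^2 < e.\<close>

lemma integral_shell_pos: "(LINT x|lborel. shell 0 1 (x::'a::euclidean_space)) > 0"
proof (rule ccontr)
  assume "\<not> ?thesis"
  then have "(LINT x|lborel. shell 0 1 (x::'a)) = 0"
    using shell_nonneg by (metis Bochner_Integration.integral_nonneg antisym_conv2 not_less)
  then have "AE x::'a in lborel. shell 0 1 x = 0"
    by (subst (asm) integral_nonneg_eq_0_iff_AE) (auto simp: shell_nonneg integrable_shell)
  then have AE: "AE x::'a in lebesgue. shell 0 1 x = 0"
    by (rule AE_completion)
  define S where "S = {x::'a. 1 < x \<bullet> x \<and> x \<bullet> x < exp 1}"
  have "open S"
    unfolding S_def by (intro open_Collect_conj open_Collect_less continuous_intros)
  have pos: "shell 0 1 x > 0" if "x \<in> S" for x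
  proof -
    have "ln (x \<bullet> x) < ln (exp 1)"
      using that by (subst ln_less_cancel_iff) (auto simp: S_def)
    with that show ?thesis
      by (auto simp: S_def shell_def)
  qed
  obtain b :: 'a where b: "b \<in> Basis"
    using nonempty_Basis by blast
  \<comment> \<open>The point \<open>exp (1/4) *\<^sub>R b\<close> has squared norm exp(1/2),
    strictly between 1 and e.\<close>
  have "exp (1/4) * exp (1/4) < exp (1::real)"
    by (simp flip: exp_add)
  then have "exp (1/4) *\<^sub>R b \<in> S"
    using b by (simp add: S_def flip: exp_add)
  moreover have "AE x \<in> S in lebesgue. x \<in> {}"
    using AE by eventually_elim (use pos in force)
  ultimately show False
    using mem_closed_if_AE_lebesgue_open[OF \<open>open S\<close> closed_empty] by blast
qed

subsection \<open>Almost extremal functions\<close>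

text \<open>With \<open>n\<close> the dimension, the exponent -n/4 is the one whose square is the
  weight in \<open>shell\<close>.\<close>

lemma cmod_radial_squared:
  "(cmod (radial (- n / 4) F (x \<bullet> x)))\<^sup>2 = (x \<bullet> x) powr (- n / 2) * (cmod (F (ln (x \<bullet> x))))\<^sup>2"
proof (cases "x = 0")
  case False
  have "((x \<bullet> x) powr (- n / 4))\<^sup>2 = (x \<bullet> x) powr (- n / 2)"
    unfolding power2_eq_square by (simp flip: powr_add)
  with False show ?thesis
    by (simp add: radial_pos norm_mult power_mult_distrib)
qed (simp add: radial_def)

lemma bump_derivatives:
  obtains b' b'' M where
    "\<And>t. (bump has_vector_derivative b' t) (at t)" "\<And>t. (b' has_vector_derivative b'' t) (at t)"
    "\<And>k. C_k k b''" "\<And>t. t \<notin> {0..1} \<Longrightarrow> b'' t = 0" "\<And>t. cmod (b'' t) \<le> M"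
proof -
  define b' where "b' t = frechet_derivative bump (at t) 1" for t
  define b'' where "b'' t = frechet_derivative b' (at t) 1" for t
  have b: "(bump has_vector_derivative b' t) (at t)" for t
    unfolding b'_def by (rule C_k_has_vector_derivative[OF C_k_bump])
  have Cb': "C_k k b'" for k
    unfolding b'_def[abs_def] by (rule C_k_frechet_derivative[OF C_k_bump])
  have b': "(b' has_vector_derivative b'' t) (at t)" for t
    unfolding b''_def by (rule C_k_has_vector_derivative[OF Cb'])
  have Cb'': "C_k k b''" for k
    unfolding b''_def[abs_def] by (rule C_k_frechet_derivative[OF Cb'])
  have "b' t = 0" if "t \<in> - {0..1}" for t
    by (rule has_vector_derivative_eq_0[OF b _ that]) (auto intro!: bump_eq_0)
  then have supp: "b'' t = 0" if "t \<notin> {0..1}" for t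
    using that by (intro has_vector_derivative_eq_0[OF b', of "- {0..1}"]) auto
  have "continuous_on {0..1} b''"
    using Cb''[of 0] by (auto intro: continuous_on_subset)
  then have "bounded (b'' ` {0..1})"
    by (intro compact_imp_bounded compact_continuous_image compact_Icc)
  then obtain M where M: "\<And>y. y \<in> b'' ` {0..1} \<Longrightarrow> cmod y \<le> M"
    unfolding bounded_iff by blast
  have "cmod (b'' t) \<le> max M 0" for t
    using M[of "b'' t"] supp[of t] by (cases "t \<in> {0..1}") (auto simp: le_max_iff_disj)
  with b b' Cb'' supp show thesis by (rule that)
qed

text \<open>Convexity of the square, with weights \<open>p / B\<close> and \<open>1 - p / B\<close>.\<close>

lemma square_add_le:
  fixes p B x y :: real
  assumes "0 < p" "p < B"
  shows "(p * x + y)\<^sup>2 \<le> p * B * x\<^sup>2 + B / (B - p) * y\<^sup>2"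
proof -
  have "p * B * x\<^sup>2 + B / (B - p) * y\<^sup>2 - (p * x + y)\<^sup>2 = p / (B - p) * ((B - p) * x - y)\<^sup>2"
    using assms by (simp add: field_simps power2_eq_square)
  also have "\<dots> \<ge> 0"
    using assms by simp
  finally show ?thesis by simp
qed

text \<open>On an interval of length L the term \<open>F''\<close> has size 1/L^2, so it contributes
  order L / L^4 to the squared norm of the image, against at least order L for the squared norm of
  \<open>radial (- n / 4) F\<close>.\<close>

lemma almost_extremal:
  fixes c B :: real and z :: complex
  defines "n \<equiv> real DIM('a::euclidean_space)"
  assumes "0 \<le> c" "c < B"
  obtains F F' F'' A A' where
    "\<And>k. C_k k F" "\<And>k. C_k k F''"
    "\<And>t. (F has_vector_derivative F' t) (at t)" "\<And>t. (F' has_vector_derivative F'' t) (at t)"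
    "\<And>t. t \<notin> {A..A'} \<Longrightarrow> F t = 0" "\<And>t. t \<notin> {A..A'} \<Longrightarrow> F'' t = 0"
    "l2_norm (\<lambda>x::'a. radial (- n / 4) F (x \<bullet> x)) > 0"
    "l2_norm (\<lambda>x::'a. radial (- n / 4) (\<lambda>t. of_real c * F t - 4 * F'' t) (x \<bullet> x)
        - z * radial (1 - n / 4) F (x \<bullet> x))
      \<le> B * l2_norm (\<lambda>x::'a. radial (- n / 4) F (x \<bullet> x))"
proof -
  obtain b' b'' M where b: "\<And>t. (bump has_vector_derivative b' t) (at t)"
      "\<And>t. (b' has_vector_derivative b'' t) (at t)"
      "\<And>k. C_k k b''" "\<And>t. t \<notin> {0..1} \<Longrightarrow> b'' t = 0" "\<And>t. cmod (b'' t) \<le> M"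
    by (rule bump_derivatives) blast
  \<comment> \<open>The gap between \<open>c\<close> and \<open>B\<close> is halved at
    \<open>p\<close>: \<epsilon> absorbs the term with \<open>z\<close>, and \<open>B - p\<close>
    the term with \<open>F''\<close>.\<close>
  define \<epsilon> where "\<epsilon> = (B - c) / 2"
  define p where "p = c + \<epsilon>"
  have \<epsilon>: "\<epsilon> > 0" and p: "0 < p" "p < B"
    using \<open>0 \<le> c\<close> \<open>c < B\<close> by (auto simp: \<epsilon>_def p_def field_simps)
  define \<delta> where "\<delta> = exp (- 8 :: real)"
  have \<delta>: "\<delta> > 0" by (simp add: \<delta>_def)
  \<comment> \<open>\<open>C / L ^ 4\<close> is the last term of \<open>square_add_le\<close> for y
    = 4 M / L^2.\<close>
  define C where "C = 16 * M\<^sup>2 * (B / (B - p))"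
  have C: "C \<ge> 0"
    using p by (simp add: C_def)
  \<comment> \<open>The size of \<open>K\<close> lets the \<open>F''\<close> error be absorbed into
    \<open>B * (B - p) * I\<close> at the end.\<close>
  obtain K :: nat where "max 1 (4 * C / \<delta>\<^sup>2 / (B * (B - p))) \<le> real K"
    using real_arch_simple by blast
  then have K: "4 * C / \<delta>\<^sup>2 / (B * (B - p)) \<le> real K" "K > 0"
    by auto
  \<comment> \<open>A multiple of 4 puts the middle half, where the bump is bounded below, between T
    + K and T + 3 K, a window of integer length.\<close>
  define N where "N = 4 * K"
  define L where "L = real N"
  have N: "N \<ge> 1" and L: "L \<ge> 1"
    using K(2) by (auto simp: N_def L_def)
  \<comment> \<open>On the support q = exp t is at most exp (T + L) < \<epsilon> / (|z| + 1), so |z|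
    q \<le> \<epsilon>; the summand 1 covers z = 0.\<close>
  define T where "T = ln (\<epsilon> / (cmod z + 1)) - L - 1"
  define \<sigma> where "\<sigma> t = (1 / L) * t + (- T / L)" for t
  have \<sigma>: "\<sigma> t = (t - T) / L" for t
    by (simp add: \<sigma>_def diff_divide_distrib)
  define F where "F t = bump (\<sigma> t)" for t
  define F' where "F' t = of_real (1 / L) * b' (\<sigma> t)" for t
  define F'' where "F'' t = of_real (1 / L\<^sup>2) * b'' (\<sigma> t)" for t
  have \<sigma>_deriv: "(\<sigma> has_vector_derivative (1 / L)) (at t)" for t
    unfolding \<sigma>_def by (auto intro!: derivative_eq_intros)
  have F: "(F has_vector_derivative F' t) (at t)" for t
    unfolding F_def[abs_def] F'_def
    using vector_diff_chain_at[OF \<sigma>_deriv b(1)] by (simp add: o_def scaleR_conv_of_real)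
  have "((\<lambda>t. b' (\<sigma> t)) has_vector_derivative of_real (1 / L) * b'' (\<sigma> t)) (at t)" for t
    using vector_diff_chain_at[OF \<sigma>_deriv b(2)] by (simp add: o_def scaleR_conv_of_real)
  from has_vector_derivative_mult_right[OF this, of "of_real (1 / L)"]
  have F': "(F' has_vector_derivative F'' t) (at t)" for t
    unfolding F'_def[abs_def] F''_def by (simp add: power2_eq_square)
  have CF: "C_k k F" for k
    unfolding F_def[abs_def] \<sigma>_def by (rule C_k_compose_affine[OF C_k_bump])
  have CF'': "C_k k F''" for k
    unfolding F''_def[abs_def] \<sigma>_def by (intro C_k_mult C_k_const C_k_compose_affine b(3))
  have \<sigma>_range: "\<sigma> t \<notin> {0..1}" if "t \<notin> {T..T + L}" for t
    using that L by (auto simp: \<sigma> field_simps)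
  have supp: "F t = 0" "F'' t = 0" if "t \<notin> {T..T + L}" for t
    using \<sigma>_range[OF that] b(4) bump_eq_0[of "\<sigma> t"] by (auto simp: F_def F''_def)
  have F''_le: "cmod (F'' t) \<le> M / L\<^sup>2" for t
    using b(5)[of "\<sigma> t"] by (simp add: F''_def norm_mult norm_divide norm_power divide_right_mono)
  have F_ge: "cmod (F t) \<ge> \<delta>" if "t \<in> {T + real K..<T + real K + real (2 * K)}" for t
  proof -
    have "\<sigma> t \<in> {1/4..3/4}"
      using that K(2) by (auto simp: \<sigma> L_def N_def field_simps)
    then show ?thesis
      unfolding F_def \<delta>_def by (rule bump_ge)
  qed
  define f where "f x = radial (- n / 4) (\<lambda>t. of_real c * F t - 4 * F'' t) (x \<bullet> x)
      - z * radial (1 - n / 4) F (x \<bullet> x)" for x :: 'a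
  define g where "g x = radial (- n / 4) F (x \<bullet> x)" for x :: 'a
  have g_test: "g \<in> test_functions (UNIV - {0})"
    unfolding g_def[abs_def] by (rule radial_test_function[OF CF supp(1)])
  have g_int: "integrable lborel (\<lambda>x. (cmod (g x))\<^sup>2)"
    using test_functions_L2[OF g_test] by (simp add: L2_def)
  define I where "I = (LINT x|lborel. (cmod (g x))\<^sup>2)"
  define m where "m = (LINT x|lborel. shell 0 1 (x::'a))"
  have m: "m > 0"
    unfolding m_def by (rule integral_shell_pos)

  \<comment> \<open>The support interval is closed but the window half-open; the extra unit in
    \<open>N + 1\<close> includes the right end point.\<close>
  have f_le: "(cmod (f x))\<^sup>2 \<le> p * B * (cmod (g x))\<^sup>2 + C / L ^ 4 * shell T (T + real (N + 1)) x" for x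
  proof (cases "x \<noteq> 0 \<and> ln (x \<bullet> x) \<in> {T..T + L}")
    case True
    define q where "q = x \<bullet> x"
    define t where "t = ln q"
    have q: "q > 0" "q = exp t"
      using True by (auto simp: q_def t_def)
    define r where "r = q powr (- n / 4)"
    have "f x = of_real r * (of_real c * F t - 4 * F'' t - z * of_real q * F t)"
    proof -
      have "q powr (1 - n / 4) = q * r"
        unfolding r_def using q(1) powr_add[of q 1 "- n / 4"] by simp
      then show ?thesis
        using q(1) unfolding f_def q_def[symmetric] by (simp add: radial_pos t_def[symmetric] r_def algebra_simps)
    qed
    then have "cmod (f x) = r * cmod (of_real c * F t - 4 * F'' t - z * of_real q * F t)"
      by (simp add: norm_mult r_def)
    also have "cmod (of_real c * F t - 4 * F'' t - z * of_real q * F t)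
        \<le> cmod (of_real c * F t) + cmod (4 * F'' t) + cmod (z * of_real q * F t)"
      by (meson add_mono_thms_linordered_semiring(3) norm_triangle_ineq4 order_trans)
    also have "\<dots> = c * cmod (F t) + 4 * cmod (F'' t) + (cmod z * q) * cmod (F t)"
      using assms q(1) by (simp add: norm_mult)
    \<comment> \<open>The choice of \<open>T\<close> bounds the term with \<open>z\<close> by
      \<epsilon> |F|, which raises the coefficient from \<open>c\<close> to
      \<open>p\<close>.\<close>
    also have "\<dots> \<le> p * cmod (F t) + 4 * M / L\<^sup>2"
    proof -
      have "q \<le> exp (T + L)"
        unfolding q(2) exp_le_cancel_iff using True by (simp add: t_def q_def)
      also have "\<dots> \<le> exp (ln (\<epsilon> / (cmod z + 1)))"
        by (simp add: T_def)
      also have "\<dots> = \<epsilon> / (cmod z + 1)"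
        using \<epsilon> by (subst exp_ln) (auto intro!: divide_pos_pos add_nonneg_pos)
      finally have "(cmod z + 1) * q \<le> \<epsilon>"
        by (simp add: pos_le_divide_eq add_nonneg_pos mult.commute)
      then have "cmod z * q \<le> \<epsilon>"
        using q(1) by (simp add: algebra_simps)
      then have "cmod z * q * cmod (F t) \<le> \<epsilon> * cmod (F t)"
        by (rule mult_right_mono) simp
      moreover have "4 * cmod (F'' t) \<le> 4 * M / L\<^sup>2"
        using F''_le[of t] by simp
      ultimately show ?thesis
        unfolding p_def distrib_right by linarith
    qed
    finally have "cmod (f x) \<le> r * (p * cmod (F t) + 4 * M / L\<^sup>2)"
      by (simp add: r_def mult_left_mono)
    then have "(cmod (f x))\<^sup>2 \<le> r\<^sup>2 * (p * cmod (F t) + 4 * M / L\<^sup>2)\<^sup>2"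
      by (metis norm_ge_zero power_mono power_mult_distrib)
    also have "\<dots> \<le> r\<^sup>2 * (p * B * (cmod (F t))\<^sup>2 + B / (B - p) * (4 * M / L\<^sup>2)\<^sup>2)"
      by (intro mult_left_mono square_add_le p) simp
    also have "B / (B - p) * (4 * M / L\<^sup>2)\<^sup>2 = C / L ^ 4"
      by (simp add: C_def power_divide power_mult_distrib flip: power_mult)
    also have "r\<^sup>2 = q powr (- n / 2)"
      unfolding r_def power2_eq_square by (simp flip: powr_add)
    also have "\<dots> * (p * B * (cmod (F t))\<^sup>2 + C / L ^ 4)
        = p * B * (cmod (g x))\<^sup>2 + C / L ^ 4 * (q powr (- n / 2))"
      unfolding g_def cmod_radial_squared by (simp add: q_def t_def algebra_simps)
    also have "q powr (- n / 2) = shell T (T + real (N + 1)) x"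
      using True by (simp add: shell_def q_def n_def L_def)
    finally show ?thesis .
  next
    case False
    have "f x = 0"
    proof (cases "x = 0")
      case False
      then show ?thesis
        using \<open>\<not> (x \<noteq> 0 \<and> _)\<close> supp[of "ln (x \<bullet> x)"] by (simp add: f_def radial_def)
    qed (simp add: f_def radial_def)
    then show ?thesis
      using p C L shell_nonneg[of T "T + real (N + 1)" x] by simp
  qed

  have g_ge: "\<delta>\<^sup>2 * shell (T + real K) (T + real K + real (2 * K)) x \<le> (cmod (g x))\<^sup>2" for x
  proof (cases "ln (x \<bullet> x) \<in> {T + real K..<T + real K + real (2 * K)}")
    case True
    from F_ge[OF this] have "\<delta>\<^sup>2 \<le> (cmod (F (ln (x \<bullet> x))))\<^sup>2"
      using \<delta> by (intro power_mono) auto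
    from mult_left_mono[OF this, of "(x \<bullet> x) powr (- n / 2)"] show ?thesis
      using True unfolding g_def cmod_radial_squared by (simp add: shell_def n_def mult.commute)
  qed (simp add: shell_def)

  \<comment> \<open>Only the middle half is kept; its mass grows linearly in
    \<open>K\<close>.\<close>
  have "\<delta>\<^sup>2 * (real (2 * K) * m) = (LINT x|lborel. \<delta>\<^sup>2 * shell (T + real K) (T + real K + real (2 * K)) (x::'a))"
    unfolding m_def integral_shell_of_nat[symmetric, of "2 * K" "T + real K"] by simp
  also have "\<dots> \<le> I"
    unfolding I_def by (intro integral_mono g_int integrable_mult_right integrable_shell g_ge)
  finally have I_ge: "\<delta>\<^sup>2 * (2 * real K * m) \<le> I"
    by simp
  moreover have "\<delta>\<^sup>2 * (2 * real K * m) > 0"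
    using \<delta> K(2) m by simp
  ultimately have I_pos: "I > 0"
    by linarith

  have "(LINT x|lborel. (cmod (f x))\<^sup>2)
      \<le> (LINT x|lborel. p * B * (cmod (g x))\<^sup>2 + C / L ^ 4 * shell T (T + real (N + 1)) x)"
    by (intro integral_mono' Bochner_Integration.integrable_add integrable_mult_right g_int integrable_shell
        f_le order_trans[OF zero_le_power2 f_le])
  also have "\<dots> = p * B * I + C / L ^ 4 * (real (N + 1) * m)"
    unfolding m_def integral_shell_of_nat[symmetric, of "N + 1" T] I_def
    by (subst Bochner_Integration.integral_add) (auto intro!: integrable_mult_right g_int integrable_shell)
  \<comment> \<open>The window of length 4 K + 1 is at most four times the middle one of length 2 K,
    whose mass is controlled by \<open>I\<close>.\<close>
  also have "\<dots> \<le> p * B * I + B * (B - p) * I"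
  proof -
    have "real (N + 1) * m \<le> 4 * (2 * real K * m)"
      using m K(2) by (simp add: N_def)
    also have "\<dots> \<le> 4 * (I / \<delta>\<^sup>2)"
      using I_ge \<delta> by (simp add: field_simps)
    finally have "C / L ^ 4 * (real (N + 1) * m) \<le> C / L ^ 4 * (4 * (I / \<delta>\<^sup>2))"
      using C L by (intro mult_left_mono) auto
    also have "\<dots> = (4 * C / \<delta>\<^sup>2) / L ^ 4 * I"
      by (simp add: mult_ac)
    also have "\<dots> \<le> B * (B - p) * I"
    proof (rule mult_right_mono)
      have "4 * C / \<delta>\<^sup>2 \<le> B * (B - p) * real K"
        using pos_divide_le_eq[THEN iffD1, OF _ K(1)] p by (simp add: mult.commute)
      \<comment> \<open>The crude chain K \<le> L \<le> L^4 is enough.\<close>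
      also have "\<dots> \<le> B * (B - p) * L ^ 4"
      proof (rule mult_left_mono)
        have "real K \<le> L" by (simp add: L_def N_def)
        also have "L ^ 1 \<le> L ^ 4"
          by (rule power_increasing) (use L in auto)
        finally show "real K \<le> L ^ 4" by simp
      qed (use p in simp)
      finally show "4 * C / \<delta>\<^sup>2 / L ^ 4 \<le> B * (B - p)"
        by (rule pos_divide_le_eq[THEN iffD2, rotated]) (use L in simp)
    qed (use I_pos in simp)
    finally show ?thesis by simp
  qed
  \<comment> \<open>The shares p B and B (B - p) are designed to add up to B^2.\<close>
  also have "\<dots> = B\<^sup>2 * I"
    by (simp add: power2_eq_square algebra_simps)
  finally have norm_f: "l2_norm f \<le> B * l2_norm g"
    using p by (simp add: l2_norm_def flip: I_def) (metis real_sqrt_le_mono real_sqrt_mult real_sqrt_abs abs_of_pos order.strict_trans)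
  have norm_g: "l2_norm g > 0"
    using I_pos by (simp add: l2_norm_def I_def)
  show thesis
    by (rule that[where A = T and A' = "T + L"])
      (fact CF CF'' F F' supp norm_g[unfolded g_def[abs_def]] norm_f[unfolded f_def[abs_def] g_def[abs_def]])+
qed

section \<open>Passage to the operator norm\<close>

lemma operator_norm_lower_bound:
  fixes z :: complex
  assumes "(real DIM('a) / 2 - 1)\<^sup>2 < B"
  shows "ennreal (1 / B) \<le> operator_norm (l2_extension (sandwiched_resolvent z :: 'a::euclidean_space l2_operator))"
proof -
  define n where "n = real DIM('a)"
  define c where "c = (n / 2 - 1)\<^sup>2"
  define f where "f F F'' = (\<lambda>x::'a. radial (- n / 4) (\<lambda>t. of_real c * F t - 4 * F'' t) (x \<bullet> x)
      - z * radial (1 - n / 4) F (x \<bullet> x))" for F F''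
  define g where "g F = (\<lambda>x::'a. radial (- n / 4) F (x \<bullet> x))" for F
  have c: "0 \<le> c" "c < B"
    using assms by (auto simp: c_def n_def)
  obtain F F' F'' A A' where F:
    "\<And>k. C_k k F" "\<And>k. C_k k F''"
    "\<And>t. (F has_vector_derivative F' t) (at t)" "\<And>t. (F' has_vector_derivative F'' t) (at t)"
    "\<And>t. t \<notin> {A..A'} \<Longrightarrow> F t = 0" "\<And>t. t \<notin> {A..A'} \<Longrightarrow> F'' t = 0"
    and pos: "l2_norm (g F) > 0" and le: "l2_norm (f F F'') \<le> B * l2_norm (g F)"
    unfolding f_def g_def n_def by (rule almost_extremal[OF c, where 'a = 'a and z = z]) blast
  \<comment> \<open>This factor gives the image norm exactly 1/B and the argument norm at most
    1.\<close>
  define k where "k = 1 / (B * l2_norm (g F))"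
  have k: "k > 0"
    using pos c by (simp add: k_def)
  \<comment> \<open>Both functions are linear in the profile, so the profile is rescaled and the
    radial lemma still applies.\<close>
  define kF where "kF t = of_real k * F t" for t
  define kF'' where "kF'' t = of_real k * F'' t" for t
  have scale: "f kF kF'' = (\<lambda>x. of_real k * f F F'' x)" "g kF = (\<lambda>x. of_real k * g F x)"
    by (auto simp: f_def g_def kF_def kF''_def radial_def fun_eq_iff algebra_simps)
  have l2_scale: "l2_norm (\<lambda>x. of_real k * h x) = k * l2_norm h" for h :: "'a \<Rightarrow> complex"
    using k by (simp add: l2_norm_def norm_mult power_mult_distrib real_sqrt_mult)
  have mem: "(f kF kF'', g kF) \<in> sandwiched_resolvent z"
    unfolding f_def g_def c_def n_def
  proof (rule sandwiched_resolvent_radial)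
    show "(kF has_vector_derivative of_real k * F' t) (at t)"
        "((\<lambda>t. of_real k * F' t) has_vector_derivative kF'' t) (at t)" for t
      unfolding kF_def[abs_def] kF''_def by (intro has_vector_derivative_mult_right F)+
    show "C_k j kF" "C_k j kF''" for j
      unfolding kF_def[abs_def] kF''_def[abs_def] by (intro C_k_mult C_k_const F)+
    show "kF t = 0" "kF'' t = 0" if "t \<notin> {A..A'}" for t
      using F(5,6)[OF that] by (auto simp: kF_def kF''_def)
  qed
  then have "f kF kF'' \<in> L2" "g kF \<in> L2"
    by (auto simp: sandwiched_resolvent_def mult_operator_def)
  \<comment> \<open>Constant sequences show that the graph lies in its closure.\<close>
  then have "(f kF kF'', g kF) \<in> l2_extension (sandwiched_resolvent z)"
    unfolding l2_extension_def mem_Collect_eq prod.case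
    by (intro conjI exI[of _ "\<lambda>_. f kF kF''"] exI[of _ "\<lambda>_. g kF"]) (simp_all add: mem l2_norm_def)
  moreover have "l2_norm (f kF kF'') \<le> 1"
    unfolding scale l2_scale using le pos c by (simp add: k_def divide_le_eq)
  moreover have "l2_norm (g kF) = 1 / B"
    unfolding scale l2_scale using pos by (simp add: k_def)
  ultimately show ?thesis
    unfolding operator_norm_def by (intro SUP_upper2[of "(f kF kF'', g kF)"]) auto
qed

theorem proposition4p2:
  fixes z :: complex
  assumes "CARD('d::finite) \<ge> 3"
    and "z \<notin> complex_of_real ` {0..}"
  shows "operator_norm (l2_extension (sandwiched_resolvent z :: (real ^ 'd) l2_operator))
           \<ge> ennreal ((real CARD('d) / 2 - 1) powi (-2))"
proof -
  define c where "c = (real CARD('d) / 2 - 1)\<^sup>2"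
  have "real CARD('d) \<ge> 3"
    using assms(1) by simp
  \<comment> \<open>Positivity of \<open>c\<close>, from d \<ge> 3, makes 1/B continuous at B =
    c.\<close>
  then have c: "c > 0"
    by (simp add: c_def)
  \<comment> \<open>The bound 1/B holds for every B > c; letting B decrease to \<open>c\<close>
    gives the sharp constant.\<close>
  have "((\<lambda>B. ennreal (1 / B)) \<longlongrightarrow> ennreal (1 / c)) (at_right c)"
    using c by (intro tendsto_intros) auto
  moreover have "\<forall>\<^sub>F B in at_right c. ennreal (1 / B)
      \<le> operator_norm (l2_extension (sandwiched_resolvent z :: (real ^ 'd) l2_operator))"
    unfolding eventually_at_filter
    by (intro always_eventually allI impI operator_norm_lower_bound) (simp add: c_def)
  ultimately have "ennreal (1 / c) \<le> operator_norm (l2_extension (sandwiched_resolvent z :: (real ^ 'd) l2_operator))"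
    by (rule tendsto_upperbound) simp
  then show ?thesis
    by (simp add: c_def power_int_minus inverse_eq_divide)
qed

end
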